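(* Let $r\ge3$ and $d\ge2$, and let $P_r$ denote a regular $r$-gon. (a) Let $S$ be a set of $T(r,d)-2$ generic points in $\mathbb{R}^d$. Then for any plane $U$ in $\mathbb{R}^d$, there exists a $P_r$-partition of $S$ with $P_r$ parallel to $U$. (b) Let $d$ be even. Then almost any $T(r,d)-d$ points in $\mathbb{R}^d$ can be $P_r$-partitioned so that $P_r$ lies in a complex 1-flat. In particular, $$N_{(P_r;d)}\le (r-2)(d+1)+2.$$
   Context: $T(r,d):=(r-1)(d+1)+1$. A coordinate plane (line) of $\mathbb{R}^D$ is the span of two distinct (one) standard basis vectors. A $P_r$-partition of a finite set $S\subset\mathbb{R}^d$ is a partition of $S$ into $r$ pairwise disjoint sets $A_1,\dots,A_r$ for which there exist points $x_j\in\mathrm{Conv}(A_j)$, $1\le j\le r$, which are the vertices (in some order) of a (non-degenerate) planar regular $r$-gon $P_r$ in $\mathbb{R}^d$. $P_r$ is parallel to a plane (2-dimensional linear subspace) $U$ if it lies in a translate of $U$. For $d$ even, $\mathbb{R}^d$ is identified with $\mathbb{C}^{d/2}$ in the standard way, and a complex 1-flat is a translate of a complex 1-dimensional linear subspace. $N_{(P_r;d)}$ is the minimum $N$ such that almost any $N$ points in $\mathbb{R}^d$ admit a $P_r$-partition. "Almost any $N$ points" means Lebesgue-almost every $N$-tuple in $(\mathbb{R}^d)^N$. **Genericity.** A set $S$ of $N$ points in $\mathbb{R}^D$ is generic if the affine map $\Delta_{N-1}\to\mathbb{R}^D$ sending the vertices of the $(N-1)$-simplex bijectively to $S$ is Fourier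 generic, as follows. Let $G=\mathbb{Z}_{q_1}\oplus\cdots\oplus\mathbb{Z}_{q_l}$ ($q_j\ge2$), with characters $\chi_h(g)=\prod_{j=1}^l\zeta_{q_j}^{h_jg_j}$, $\zeta_q=e^{2\pi i/q}$, for $g,h\in G$. For a map $F=(F_1,\dots,F_{a+b}):\Delta_n\to\mathbb{C}^a\oplus\mathbb{R}^{b}$ and points $\{x_g\}_{g\in G}\subset\Delta_n$, the Fourier coefficients are $c_{i,h}=\frac1{|G|}\sum_{g\in G}F_i(x_g)\chi_h(g)^{-1}$. Points have pairwise disjoint support if they lie in pairwise disjoint faces. An admissible choice is a family $S_i\subseteq G\setminus\{0\}$, $1\le i\le a+b$, such that for each $i>a$, writing $T_i=\{h\in S_i: h\text{ has order }2\}$, one has $-h\notin S_i$ whenever $h\in S_i\setminus T_i$; put $m=\sum_{i=1}^{a+b}|S_i|$ and $m'=\sum_{i=a+1}^{a+b}|T_i|$. A map $f:\Delta_M\to\mathbb{R}^D$ is Fourier generic if for every such group $G$, every decomposition $\mathbb{R}^D=\bigoplus_{i=1}^aU_i\oplus\bigoplus_{j=1}^{b}L_j$ ($D=2a+b$, $a,b\ge0$, $a+b\ge1$) into pairwise orthogonal coordinate planes $U_i$ and coordinate lines $L_j$, with $\sigma:\mathbb{R}^D\to\mathbb{C}^a\oplus\mathbb{R}^{b}$ a coordinate permutation sending $U_i$ to the $i$-th complex coordinate plane and $L_j$ to the $j$-th real coordinate line, every admissible choice of the $S_i$, and every face $\Delta_n$ of $\Delta_M$ with $n<2m-m'+|G|-1$,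 there is no $\{x_g\}_{g\in G}\subset\Delta_n$ with pairwise disjoint support for which all Fourier coefficients $c_{i,h}$ of $(\sigma\circ f)|_{\Delta_n}$ with $h\in S_i$, $1\le i\le a+b$, vanish. *)

theory Defs
  imports
    "HOL-Analysis.Analysis"
    "HOL-Algebra.Multiplicative_Group"
    "HOL-Algebra.Product_Groups"
    "HOL-Homology.Simplices"
begin

definition tverberg_number :: "nat \<Rightarrow> nat \<Rightarrow> nat" where
  "tverberg_number r d = (r - 1) * (d + 1) + 1"


section \<open>Regular polygons and polygon partitions\<close>

text \<open>\<open>V\<close> is the vertex set of a non-degenerate planar regular \<open>r\<close>-gon; the polygon itself
  is \<open>convex hull V\<close>.\<close>

definition regular_gon_vertices :: "nat \<Rightarrow> (real^'n) set \<Rightarrow> bool" where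
  "regular_gon_vertices r V \<longleftrightarrow>
     (\<exists>c u v. \<exists>\<rho>>0. norm u = 1 \<and> norm v = 1 \<and> u \<bullet> v = 0 \<and>
        V = (\<lambda>j. c + \<rho> *\<^sub>R (cos (2 * pi * real j / real r) *\<^sub>R u + sin (2 * pi * real j / real r) *\<^sub>R v))
              ` {..<r})"

text \<open>\<open>A 0, \<dots>, A (r - 1)\<close> is a \<open>P\<^sub>r\<close>-partition of \<open>S\<close>, witnessed by a regular \<open>r\<close>-gon with
  vertex set \<open>V\<close>. The bijection allows the vertices to occur in any order.\<close>

definition polygon_partition ::
    "nat \<Rightarrow> (real^'n) set \<Rightarrow> (nat \<Rightarrow> (real^'n) set) \<Rightarrow> (real^'n) set \<Rightarrow> bool" where
  "polygon_partition r S A V \<longleftrightarrow>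
     finite S \<and> disjoint_family_on A {..<r} \<and> (\<Union>j<r. A j) = S \<and>
     regular_gon_vertices r V \<and>
     (\<exists>x. (\<forall>j<r. x j \<in> convex hull A j) \<and> bij_betw x {..<r} V)"

definition parallel_to :: "(real^'n) set \<Rightarrow> (real^'n) set \<Rightarrow> bool" where
  "parallel_to P U \<longleftrightarrow> (\<exists>w. P \<subseteq> (+) w ` U)"

text \<open>An \<open>N\<close>-tuple of points is a function on \<open>{..<N}\<close>, and \<open>(\<real>\<^sup>d)\<^sup>N\<close> carries the product of the
  Lebesgue measures.\<close>

definition almost_any_points :: "nat \<Rightarrow> ((real^'n) set \<Rightarrow> bool) \<Rightarrow> bool" where
  "almost_any_points N Q \<longleftrightarrow>
     (AE x in PiM {..<N} (\<lambda>_. lborel :: (real^'n) measure). Q (x ` {..<N}))"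

definition polygon_number :: "'n::finite itself \<Rightarrow> nat \<Rightarrow> nat" where
  "polygon_number _ r =
     (LEAST N. almost_any_points N (\<lambda>S :: (real^'n) set. \<exists>A V. polygon_partition r S A V))"


section \<open>Complex 1-flats\<close>

text \<open>For even \<open>d\<close>, an enumeration \<open>e\<close> of the coordinates of \<open>\<real>\<^sup>d\<close> gives the identification
  with \<open>\<complex>\<^bsup>d/2\<^esup>\<close> whose \<open>k\<close>-th complex coordinate is \<open>x\<^bsub>2k\<^esub> + \<i> x\<^bsub>2k+1\<^esub>\<close>.\<close>

definition complex_coord :: "(nat \<Rightarrow> 'n) \<Rightarrow> real^'n \<Rightarrow> nat \<Rightarrow> complex" where
  "complex_coord e x k = Complex (x $ e (2 * k)) (x $ e (2 * k + 1))"

definition complex_line :: "(nat \<Rightarrow> 'n::finite) \<Rightarrow> (real^'n) set \<Rightarrow> bool" where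
  "complex_line e L \<longleftrightarrow>
     (\<exists>v. v \<noteq> 0 \<and>
        L = {x. \<exists>z. \<forall>k < CARD('n) div 2. complex_coord e x k = z * complex_coord e v k})"

definition complex_1_flat :: "(nat \<Rightarrow> 'n::finite) \<Rightarrow> (real^'n) set \<Rightarrow> bool" where
  "complex_1_flat e F \<longleftrightarrow> (\<exists>w L. complex_line e L \<and> F = (+) w ` L)"


section \<open>Fourier genericity\<close>

definition cyclic_sum :: "nat \<Rightarrow> (nat \<Rightarrow> nat) \<Rightarrow> (nat \<Rightarrow> int) monoid" where
  "cyclic_sum l q = product_group {..<l} (\<lambda>j. integer_mod_group (q j))"

definition zeta :: "nat \<Rightarrow> complex" where
  "zeta q = exp (2 * of_real pi * \<i> / of_nat q)"

definition chi :: "nat \<Rightarrow> (nat \<Rightarrow> nat) \<Rightarrow> (nat \<Rightarrow> int) \<Rightarrow> (nat \<Rightarrow> int) \<Rightarrow> complex" where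
  "chi l q h g = (\<Prod>j<l. zeta (q j) powi (h j * g j))"

text \<open>A decomposition of \<open>\<real>\<^sup>D\<close>, \<open>D = 2a + b\<close>, into coordinate planes and lines together with the
  coordinate permutation \<open>\<sigma>\<close> onto \<open>\<complex>\<^sup>a \<oplus> \<real>\<^sup>b\<close> is the same as an enumeration \<open>p\<close> of the \<open>D\<close>
  coordinates: \<open>U\<^sub>i\<close> is spanned by the basis vectors \<open>p (2i)\<close>, \<open>p (2i+1)\<close> and \<open>L\<^sub>j\<close> by the basis
  vector \<open>p (2a+j)\<close>. Indices start at \<open>0\<close>, so the real coordinates are those with
  \<open>a \<le> i < a + b\<close>.\<close>

definition sigma_coord :: "(nat \<Rightarrow> 'n) \<Rightarrow> nat \<Rightarrow> real^'n \<Rightarrow> nat \<Rightarrow> complex" where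
  "sigma_coord p a y i =
     (if i < a then Complex (y $ p (2 * i)) (y $ p (2 * i + 1)) else of_real (y $ p (a + i)))"

definition fourier_coeff ::
    "nat \<Rightarrow> (nat \<Rightarrow> nat) \<Rightarrow> ((nat \<Rightarrow> real) \<Rightarrow> nat \<Rightarrow> complex) \<Rightarrow> ((nat \<Rightarrow> int) \<Rightarrow> (nat \<Rightarrow> real))
      \<Rightarrow> nat \<Rightarrow> (nat \<Rightarrow> int) \<Rightarrow> complex" where
  "fourier_coeff l q F x i h =
     (1 / of_nat (order (cyclic_sum l q))) *
     (\<Sum>g \<in> carrier (cyclic_sum l q). F (x g) i * inverse (chi l q h g))"

definition admissible :: "(nat \<Rightarrow> int) monoid \<Rightarrow> nat \<Rightarrow> nat \<Rightarrow> (nat \<Rightarrow> (nat \<Rightarrow> int) set) \<Rightarrow> bool" where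
  "admissible G a b S \<longleftrightarrow>
     (\<forall>i < a + b. S i \<subseteq> carrier G - {\<one>\<^bsub>G\<^esub>}) \<and>
     (\<forall>i \<in> {a..<a + b}. \<forall>h \<in> S i. group.ord G h \<noteq> 2 \<longrightarrow> inv\<^bsub>G\<^esub> h \<notin> S i)"

definition simplex_face :: "nat \<Rightarrow> nat set \<Rightarrow> (nat \<Rightarrow> real) set" where
  "simplex_face M K = {t \<in> standard_simplex M. \<forall>i. i \<notin> K \<longrightarrow> t i = 0}"

definition disjoint_support :: "nat \<Rightarrow> 'g set \<Rightarrow> ('g \<Rightarrow> (nat \<Rightarrow> real)) \<Rightarrow> bool" where
  "disjoint_support M I x \<longleftrightarrow>
     (\<exists>L. (\<forall>g\<in>I. L g \<subseteq> {..M} \<and> x g \<in> simplex_face M (L g)) \<and>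
          disjoint_family_on (\<lambda>g. simplex_face M (L g)) I)"

definition fourier_generic :: "nat \<Rightarrow> ((nat \<Rightarrow> real) \<Rightarrow> real^'n::finite) \<Rightarrow> bool" where
  "fourier_generic M f \<longleftrightarrow>
     (\<forall>l q a b p S K n.
        (\<forall>j<l. q j \<ge> 2) \<and>
        2 * a + b = CARD('n) \<and> a + b \<ge> 1 \<and>
        bij_betw p {..<2 * a + b} (UNIV :: 'n set) \<and>
        admissible (cyclic_sum l q) a b S \<and>
        K \<subseteq> {..M} \<and> card K = n + 1 \<and>
        int n < 2 * (\<Sum>i<a + b. int (card (S i)))
                - (\<Sum>i = a..<a + b. int (card {h \<in> S i. group.ord (cyclic_sum l q) h = 2}))
                + int (order (cyclic_sum l q)) - 1
        \<longrightarrow>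
        \<not> (\<exists>x. (\<forall>g \<in> carrier (cyclic_sum l q). x g \<in> simplex_face M K) \<and>
               disjoint_support M (carrier (cyclic_sum l q)) x \<and>
               (\<forall>i < a + b. \<forall>h \<in> S i.
                  fourier_coeff l q (\<lambda>t. sigma_coord p a (f t)) x i h = 0)))"

text \<open>The choice of the bijection \<open>v\<close> between the vertices and \<open>S\<close> is immaterial, because Fourier
  genericity is invariant under permuting the vertices of the simplex.\<close>

definition generic_set :: "(real^'n::finite) set \<Rightarrow> bool" where
  "generic_set S \<longleftrightarrow>
     finite S \<and> S \<noteq> {} \<and>
     (\<exists>v. bij_betw v {..card S - 1} S \<and>
          fourier_generic (card S - 1) (\<lambda>t. \<Sum>i\<le>card S - 1. t i *\<^sub>R v i))"

end

theory Submission
  imports Defs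
begin

text \<open>A map from \<open>{..<r}\<close> to \<open>\<real>\<^sup>d\<close> traces a regular \<open>r\<close>-gon parallel to a plane if its complex
  coordinate along the plane has the form \<open>j \<mapsto> \<alpha> + \<beta> \<zeta>\<^sup>j\<close> with \<open>\<beta> \<noteq> 0\<close> and the remaining real
  coordinates are constant; it traces one in a complex 1-flat if every complex coordinate has this
  form and some \<open>\<beta>\<close> is nonzero. The sequences \<open>\<alpha> + \<beta> \<zeta>\<^sup>j\<close> are the solutions of a linear recurrence
  with characteristic polynomial \<open>(X - 1)(X - \<zeta>)\<close>, that is, of \<open>r - 2\<close> complex equations, whereas
  constancy of a real coordinate amounts to \<open>r - 1\<close> real equations. Together with the \<open>r - 1\<close>
  equations that equate the total weights of the parts, this is one real equation fewer than there
  are points. All these equations kill constant sequences, so Sarkaria's trick reduces the existence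
  of a partition to the colourful Caratheodory theorem. If \<open>\<beta> = 0\<close>, the partition is a Tverberg
  partition of at most \<open>T(r,d) - 1\<close> points, which Fourier genericity (with \<open>G = \<int>\<^sub>r\<close> and one frequency
  out of each pair \<open>\<plusminus>h\<close> in every real coordinate) forbids, and which does not exist for almost all
  points.\<close>

section \<open>The colourful Caratheodory theorem\<close>

text \<open>Gaussian elimination by induction on the set of equations: a pivot \<open>w i0 k\<close>
  serves to solve equation \<open>k\<close> for the unknown \<open>\<mu> i0\<close>, which costs one
  equation and one unknown.\<close>

lemma underdetermined_system:
  fixes w :: "'i \<Rightarrow> 'k \<Rightarrow> real"
  assumes "finite K" "finite I" "card K < card I"
  shows "\<exists>\<mu>. (\<exists>i\<in>I. \<mu> i \<noteq> 0) \<and> (\<forall>k\<in>K. (\<Sum>i\<in>I. \<mu> i * w i k) = 0)"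
  using assms
proof (induction K arbitrary: I w rule: finite_induct)
  case empty
  then obtain i where "i \<in> I" by fastforce
  then show ?case by (intro exI[of _ "\<lambda>_. 1"]) auto
next
  case (insert k K)
  show ?case
  proof (cases "\<forall>i\<in>I. w i k = 0")
    case True
    obtain \<mu> where "\<exists>i\<in>I. \<mu> i \<noteq> 0" "\<forall>k\<in>K. (\<Sum>i\<in>I. \<mu> i * w i k) = 0"
      using insert.IH[of I w] insert.prems insert.hyps by auto
    then show ?thesis using True by (intro exI[of _ \<mu>]) auto
  next
    case False
    then obtain i0 where i0: "i0 \<in> I" "w i0 k \<noteq> 0" by auto
    let ?J = "I - {i0}"
    \<comment> \<open>\<open>w'\<close> is the system after substituting the solution for
      \<open>\<mu> i0\<close>; the coefficient \<open>c\<close> below is the value of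
      \<open>\<mu> i0\<close> that equation \<open>k\<close> forces.\<close>
    define w' where "w' i l = w i l - w i k / w i0 k * w i0 l" for i l
    have "card K < card ?J" using insert.prems insert.hyps i0 by simp
    then obtain \<mu> where \<mu>: "\<exists>i\<in>?J. \<mu> i \<noteq> 0" "\<forall>l\<in>K. (\<Sum>i\<in>?J. \<mu> i * w' i l) = 0"
      using insert.IH[of ?J w'] insert.prems by auto
    define c where "c = - (\<Sum>i\<in>?J. \<mu> i * w i k) / w i0 k"
    have split: "(\<Sum>i\<in>I. (\<mu>(i0 := c)) i * w i l) = c * w i0 l + (\<Sum>i\<in>?J. \<mu> i * w i l)" for l
      using insert.prems i0 by (subst sum.remove[of I i0]) (auto intro!: sum.cong)
    have "(\<Sum>i\<in>?J. \<mu> i * w' i l) = c * w i0 l + (\<Sum>i\<in>?J. \<mu> i * w i l)" for l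
      unfolding w'_def c_def
      by (simp add: right_diff_distrib sum_subtractf sum_divide_distrib sum_distrib_right mult.assoc
                    sum_negf)
    then have "\<forall>l\<in>K. (\<Sum>i\<in>I. (\<mu>(i0 := c)) i * w i l) = 0" using \<mu> split by simp
    moreover have "(\<Sum>i\<in>I. (\<mu>(i0 := c)) i * w i k) = 0"
    proof -
      have "(\<Sum>i\<in>I. (\<mu>(i0 := c)) i * w i k) = c * w i0 k + (\<Sum>i\<in>?J. \<mu> i * w i k)"
        by (rule split)
      also have "\<dots> = 0" using i0 by (simp add: c_def)
      finally show ?thesis .
    qed
    moreover have "\<exists>i\<in>I. (\<mu>(i0 := c)) i \<noteq> 0" using \<mu>(1) by auto
    ultimately show ?thesis by (intro exI[of _ "\<mu>(i0 := c)"]) blast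
  qed
qed

text \<open>A quadratic that vanishes at 0 and is nonnegative just to the right of 0 has nonnegative
  derivative there. It serves as the first-order condition at a minimum over a convex set.\<close>

lemma nonneg_slope:
  fixes D B :: real
  assumes "\<And>t. 0 < t \<Longrightarrow> t \<le> 1 \<Longrightarrow> 0 \<le> 2 * t * D + t\<^sup>2 * B"
  shows "0 \<le> D"
proof (rule ccontr)
  assume "\<not> 0 \<le> D"
  \<comment> \<open>This step satisfies \<open>t * \<bar>B\<bar> \<le> - D\<close>, so that
    \<open>2 * D + t * B \<le> D < 0\<close>.\<close>
  define t where "t = min 1 (- D / (\<bar>B\<bar> + 1))"
  have t: "0 < t" "t \<le> 1" "t \<le> - D / (\<bar>B\<bar> + 1)"
    using \<open>\<not> 0 \<le> D\<close> by (auto simp: t_def divide_neg_pos)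
  then have tB: "t * (\<bar>B\<bar> + 1) \<le> - D" by (subst (asm) pos_le_divide_eq) auto
  have "0 \<le> t * (2 * D + t * B)" using assms[OF t(1,2)] by (simp add: power2_eq_square algebra_simps)
  then have "0 \<le> 2 * D + t * B" using t(1) by (simp add: zero_le_mult_iff)
  moreover have "t * B \<le> t * (\<bar>B\<bar> + 1)" using t(1) by (intro mult_left_mono) auto
  ultimately show False using tB \<open>\<not> 0 \<le> D\<close> by linarith
qed

text \<open>Weights are functions on all of \<open>nat\<close>, so compactness refers to the product
  topology: pinning the values from \<open>N\<close> on to 0 makes the set a closed subset of the
  Tychonoff cube.\<close>

lemma compact_weights:
  "compact {\<nu> :: nat \<Rightarrow> real. (\<forall>i<N. 0 \<le> \<nu> i) \<and> (\<forall>i\<ge>N. \<nu> i = 0) \<and> (\<Sum>i<N. \<nu> i) = 1}"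
  (is "compact ?S")
proof -
  have "compact (\<Pi>\<^sub>E i\<in>UNIV. {0..1::real} :: (nat \<Rightarrow> real) set)"
    using compactin_PiE[of "\<lambda>_. euclidean" UNIV "\<lambda>_. {0..1::real}"]
    by (simp add: euclidean_product_topology)
  moreover have "closed ?S"
  proof -
    have "?S = (\<Inter>i\<in>{..<N}. {\<nu>. 0 \<le> \<nu> i}) \<inter> (\<Inter>i\<in>{N..}. {\<nu>. \<nu> i = 0}) \<inter> {\<nu>. (\<Sum>i<N. \<nu> i) = 1}"
      by auto
    also have "closed \<dots>"
      by (intro closed_Int closed_INT ballI closed_Collect_le closed_Collect_eq continuous_on_sum
          continuous_on_const continuous_on_product_coordinates)
    finally show ?thesis .
  qed
  moreover have "?S \<subseteq> (\<Pi>\<^sub>E i\<in>UNIV. {0..1})"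
  proof (clarsimp simp: PiE_UNIV_domain)
    fix \<nu> :: "nat \<Rightarrow> real" and i
    assume a: "\<forall>i<N. 0 \<le> \<nu> i" "\<forall>i\<ge>N. \<nu> i = 0" "(\<Sum>i<N. \<nu> i) = 1"
    show "0 \<le> \<nu> i \<and> \<nu> i \<le> 1"
      using a member_le_sum[of i "{..<N}" \<nu>] by (cases "i < N") auto
  qed
  ultimately show ?thesis
    using compact_Int_closed[of "\<Pi>\<^sub>E i\<in>UNIV. {0..1::real}" ?S] by (simp add: Int_absorb1)
qed

text \<open>Minimize the distance from the origin over all rainbow convex combinations. A point of minimal
  positive distance has only positive weights, as a vector of weight zero could be exchanged within
  its colour for one with nonpositive inner product; but a linear dependence among the \<open>N > card K\<close>
  vectors moves a weight to zero without changing the point.\<close>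

lemma colourful_caratheodory:
  fixes w :: "nat \<Rightarrow> nat \<Rightarrow> 'k \<Rightarrow> real"
  assumes "finite K" "card K < N" "r > 0"
    and zero: "\<And>i k. i < N \<Longrightarrow> k \<in> K \<Longrightarrow> (\<Sum>j<r. w i j k) = 0"
  obtains s \<nu> where "\<And>i. i < N \<Longrightarrow> s i < r" "\<And>i. i < N \<Longrightarrow> 0 \<le> \<nu> i" "(\<Sum>i<N. \<nu> i) = 1"
    "\<And>k. k \<in> K \<Longrightarrow> (\<Sum>i<N. \<nu> i * w i (s i) k) = 0"
proof -
  define \<Delta> where "\<Delta> = {\<nu> :: nat \<Rightarrow> real. (\<forall>i<N. 0 \<le> \<nu> i) \<and> (\<forall>i\<ge>N. \<nu> i = 0) \<and> (\<Sum>i<N. \<nu> i) = 1}"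
  \<comment> \<open>\<open>p s \<nu>\<close> is the rainbow combination for the selection
    \<open>s\<close> of one vector per colour, and \<open>Q s \<nu>\<close> is its squared
    length.\<close>
  define p where "p s \<nu> k = (\<Sum>i<N. \<nu> i * w i (s i) k)" for s \<nu> k
  define Q where "Q s \<nu> = (\<Sum>k\<in>K. (p s \<nu> k)\<^sup>2)" for s \<nu>
  have "N > 0" using assms by simp
  have "(\<lambda>i. if i = 0 then 1 else 0) \<in> \<Delta>" using \<open>N > 0\<close> by (auto simp: \<Delta>_def)
  then have "\<Delta> \<noteq> {}" by blast
  have "compact \<Delta>" unfolding \<Delta>_def by (rule compact_weights)
  have "continuous_on \<Delta> (Q s)" for s
    unfolding Q_def p_def by (intro continuous_intros continuous_on_subset[OF continuous_on_product_coordinates]) auto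
  then have "\<exists>\<nu>\<in>\<Delta>. \<forall>\<nu>'\<in>\<Delta>. Q s \<nu> \<le> Q s \<nu>'" for s
    using continuous_attains_inf[OF \<open>compact \<Delta>\<close> \<open>\<Delta> \<noteq> {}\<close>] by blast
  then obtain opt where opt: "\<And>s. opt s \<in> \<Delta>" "\<And>s \<nu>. \<nu> \<in> \<Delta> \<Longrightarrow> Q s (opt s) \<le> Q s \<nu>" by metis
  \<comment> \<open>Extensional selections form a finite set, so the minima \<open>opt s\<close> for
    the single selections include a smallest one, which minimizes over all pairs.\<close>
  define Sel where "Sel = (\<Pi>\<^sub>E i\<in>{..<N}. {..<r})"
  have "finite Sel" "Sel \<noteq> {}" using \<open>r > 0\<close> by (auto simp: Sel_def PiE_eq_empty_iff intro!: finite_PiE)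
  then obtain s where s: "s \<in> Sel" "\<And>s'. s' \<in> Sel \<Longrightarrow> Q s (opt s) \<le> Q s' (opt s')"
    using ex_is_arg_min_if_finite[of Sel "\<lambda>s. Q s (opt s)"] unfolding is_arg_min_linorder by blast
  define m where "m = Q s (opt s)"
  have min: "m \<le> Q s' \<nu>" if "s' \<in> Sel" "\<nu> \<in> \<Delta>" for s' \<nu>
    using s(2)[OF that(1)] opt(2)[OF that(2), of s'] unfolding m_def by linarith
  have slt: "s i < r" if "i < N" for i using s(1) that by (auto simp: Sel_def)
  \<comment> \<open>All admissible vectors lie beyond the hyperplane through the minimal point
    perpendicular to it, as otherwise moving towards them would shorten it. A new colour vector
    \<open>j\<close> is admissible when its old one has weight zero, since switching then does not
    move the point.\<close>
  have slope: "m \<le> (\<Sum>k\<in>K. p s \<nu> k * w i j k)"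
    if "\<nu> \<in> \<Delta>" "Q s \<nu> = m" "i < N" "j < r" "j = s i \<or> \<nu> i = 0" for \<nu> i j
  proof -
    let ?s = "s(i := j)"
    have same: "p ?s \<nu> k = p s \<nu> k" for k
      unfolding p_def using that(5) by (intro sum.cong) auto
    have s': "?s \<in> Sel" using s(1) that by (auto simp: Sel_def PiE_iff extensional_def)
    have "0 \<le> (\<Sum>k\<in>K. p s \<nu> k * (w i j k - p s \<nu> k))"
    proof (rule nonneg_slope)
      fix t :: real assume t: "0 < t" "t \<le> 1"
      \<comment> \<open>The move towards \<open>w i j\<close>: the weights shift by \<open>t\<close>
        towards the unit mass at \<open>i\<close>.\<close>
      define \<nu>' where "\<nu>' l = (1 - t) * \<nu> l + t * (if l = i then 1 else 0)" for l
      have "\<nu>' \<in> \<Delta>" using that(1,3) t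
        by (auto simp: \<Delta>_def \<nu>'_def sum.distrib sum_distrib_left[symmetric])
      have p': "p ?s \<nu>' k = p s \<nu> k + t * (w i j k - p s \<nu> k)" for k
      proof -
        have "p ?s \<nu>' k = (\<Sum>l<N. (1 - t) * (\<nu> l * w l (?s l) k) + (if l = i then t * w i j k else 0))"
          unfolding p_def \<nu>'_def by (intro sum.cong) (auto simp: algebra_simps)
        also have "\<dots> = (1 - t) * p ?s \<nu> k + t * w i j k"
          using that(3) by (simp add: sum.distrib sum_distrib_left p_def)
        finally show ?thesis unfolding same by (simp add: algebra_simps)
      qed
      have "Q s \<nu> \<le> Q ?s \<nu>'" using min[OF s' \<open>\<nu>' \<in> \<Delta>\<close>] that(2) by simp
      also have "\<dots> = Q s \<nu> + (2 * t * (\<Sum>k\<in>K. p s \<nu> k * (w i j k - p s \<nu> k))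
                       + t\<^sup>2 * (\<Sum>k\<in>K. (w i j k - p s \<nu> k)\<^sup>2))"
        unfolding Q_def p' sum_distrib_left sum.distrib[symmetric]
        by (intro sum.cong) (auto simp: power2_eq_square algebra_simps)
      finally show "0 \<le> 2 * t * (\<Sum>k\<in>K. p s \<nu> k * (w i j k - p s \<nu> k))
                       + t\<^sup>2 * (\<Sum>k\<in>K. (w i j k - p s \<nu> k)\<^sup>2)" by linarith
    qed
    also have "\<dots> = (\<Sum>k\<in>K. p s \<nu> k * w i j k) - Q s \<nu>"
      unfolding Q_def by (simp add: right_diff_distrib sum_subtractf power2_eq_square)
    finally show ?thesis using that(2) by simp
  qed
  \<comment> \<open>At weight zero all \<open>r\<close> vectors of colour \<open>i\<close> would
    have positive inner product with the point, although their sum is zero.\<close>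
  have pos: "0 < \<nu> i" if "\<nu> \<in> \<Delta>" "Q s \<nu> = m" "i < N" "m > 0" for \<nu> i
  proof (rule ccontr)
    assume "\<not> 0 < \<nu> i"
    then have "\<nu> i = 0" using that(1,3) by (fastforce simp: \<Delta>_def)
    then have pj: "0 < (\<Sum>k\<in>K. p s \<nu> k * w i j k)" if "j < r" for j
      using slope[OF \<open>\<nu> \<in> \<Delta>\<close> \<open>Q s \<nu> = m\<close> \<open>i < N\<close> that] \<open>m > 0\<close> by simp
    have "0 < (\<Sum>j<r. \<Sum>k\<in>K. p s \<nu> k * w i j k)"
    proof (rule sum_pos)
      show "{..<r} \<noteq> {}" using \<open>r > 0\<close> by auto
    qed (use pj in simp_all)
    also have "\<dots> = (\<Sum>k\<in>K. p s \<nu> k * (\<Sum>j<r. w i j k))"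
      by (subst sum.swap) (simp add: sum_distrib_left)
    finally show False using zero[OF \<open>i < N\<close>] by simp
  qed
  have "m = 0"
  proof (rule ccontr)
    assume "m \<noteq> 0"
    then have "m > 0" unfolding m_def Q_def by (simp add: sum_nonneg order_less_le)
    define \<nu> where "\<nu> = opt s"
    have \<nu>: "\<nu> \<in> \<Delta>" "Q s \<nu> = m" using opt(1) by (auto simp: \<nu>_def m_def)
    define h where "h i = (\<Sum>k\<in>K. p s \<nu> k * w i (s i) k)" for i
    have hge: "m \<le> h i" if "i < N" for i unfolding h_def using slope[OF \<nu> that slt[OF that]] by simp
    \<comment> \<open>The average of \<open>h\<close> with the weights \<open>\<nu>\<close> is
      \<open>m\<close>, while every \<open>h i\<close> is at least \<open>m\<close> and every weight
      is positive; hence \<open>h\<close> is constantly \<open>m\<close>.\<close>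
    have "(\<Sum>i<N. \<nu> i * h i) = (\<Sum>k\<in>K. p s \<nu> k * (\<Sum>i<N. \<nu> i * w i (s i) k))"
      unfolding h_def sum_distrib_left by (subst sum.swap) (simp add: mult.left_commute)
    also have "\<dots> = m" using \<nu>(2) by (simp add: Q_def p_def[symmetric] power2_eq_square)
    finally have "(\<Sum>i<N. \<nu> i * (h i - m)) = 0"
      using \<nu>(1) by (simp add: right_diff_distrib sum_subtractf sum_distrib_right[symmetric] \<Delta>_def)
    then have "\<forall>i\<in>{..<N}. \<nu> i * (h i - m) = 0"
      using hge \<nu>(1) by (subst (asm) sum_nonneg_eq_0_iff) (auto simp: \<Delta>_def)
    then have "\<nu> i * (h i - m) = 0" if "i < N" for i using that by blast
    then have heq: "h i = m" if "i < N" for i using pos[OF \<nu> that \<open>m > 0\<close>] that by fastforce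
    obtain \<mu> where \<mu>: "\<exists>i\<in>{..<N}. \<mu> i \<noteq> 0" "\<forall>k\<in>K. (\<Sum>i<N. \<mu> i * w i (s i) k) = 0"
      using underdetermined_system[of K "{..<N}" "\<lambda>i. w i (s i)"] assms by auto
    \<comment> \<open>Pairing the dependence with the minimal point gives \<open>m\<close> times the
      sum of \<open>\<mu>\<close>. That sum is therefore zero, and adding multiples of
      \<open>\<mu>\<close> to \<open>\<nu>\<close> preserves total weight 1.\<close>
    have "(\<Sum>i<N. \<mu> i * h i) = (\<Sum>k\<in>K. p s \<nu> k * (\<Sum>i<N. \<mu> i * w i (s i) k))"
      unfolding h_def sum_distrib_left by (subst sum.swap) (simp add: mult.left_commute)
    also have "\<dots> = 0" using \<mu>(2) by simp
    finally have "(\<Sum>i<N. \<mu> i) * m = 0" using heq by (simp add: sum_distrib_right)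
    then have sum0: "(\<Sum>i<N. \<mu> i) = 0" using \<open>m > 0\<close> by simp
    define J where "J = {i. i < N \<and> \<mu> i < 0}"
    have "J \<noteq> {}"
    proof
      assume "J = {}"
      then have "\<forall>i\<in>{..<N}. 0 \<le> \<mu> i" unfolding J_def
        by (metis (mono_tags, lifting) empty_Collect_eq lessThan_iff not_less)
      then have "\<forall>i\<in>{..<N}. \<mu> i = 0" using sum0 by (subst (asm) sum_nonneg_eq_0_iff) auto
      then show False using \<mu>(1) by blast
    qed
    moreover have "finite J" by (simp add: J_def)
    ultimately obtain i0 where i0: "i0 \<in> J" "\<And>i. i \<in> J \<Longrightarrow> \<nu> i0 / - \<mu> i0 \<le> \<nu> i / - \<mu> i"
      using ex_is_arg_min_if_finite[of J "\<lambda>i. \<nu> i / - \<mu> i"] unfolding is_arg_min_linorder by blast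
    \<comment> \<open>The largest multiple of \<open>\<mu>\<close> that can be added without a
      negative weight; the weight at \<open>i0\<close> becomes 0.\<close>
    define t where "t = \<nu> i0 / - \<mu> i0"
    have i0': "i0 < N" "\<mu> i0 < 0" using i0(1) by (auto simp: J_def)
    have "t \<ge> 0" using i0' \<nu>(1) by (auto simp: t_def \<Delta>_def divide_nonneg_neg)
    define \<nu>' where "\<nu>' i = (if i < N then \<nu> i + t * \<mu> i else 0)" for i
    have "0 \<le> \<nu> i + t * \<mu> i" if "i < N" for i
    proof (cases "\<mu> i < 0")
      case True
      then have "t \<le> \<nu> i / - \<mu> i" using i0(2)[of i] that by (simp add: J_def t_def)
      then have "t * - \<mu> i \<le> \<nu> i" using True by (subst (asm) pos_le_divide_eq) auto
      then show ?thesis by simp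
    next
      case False
      then show ?thesis using \<open>t \<ge> 0\<close> \<nu>(1) that by (simp add: \<Delta>_def)
    qed
    moreover have "(\<Sum>i<N. \<nu>' i) = 1"
      using \<nu>(1) sum0 by (simp add: \<nu>'_def sum.distrib sum_distrib_left[symmetric] \<Delta>_def)
    ultimately have "\<nu>' \<in> \<Delta>" by (simp add: \<Delta>_def \<nu>'_def)
    have "p s \<nu>' k = p s \<nu> k" if "k \<in> K" for k
    proof -
      have "p s \<nu>' k = (\<Sum>i<N. \<nu> i * w i (s i) k + t * (\<mu> i * w i (s i) k))"
        unfolding p_def \<nu>'_def by (intro sum.cong) (auto simp: algebra_simps)
      then show ?thesis using \<mu>(2) that by (simp add: sum.distrib sum_distrib_left[symmetric] p_def)
    qed
    then have "Q s \<nu>' = m" using \<nu>(2) by (simp add: Q_def)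
    moreover have "\<nu>' i0 = 0" using i0' by (simp add: \<nu>'_def t_def)
    ultimately show False using pos[OF \<open>\<nu>' \<in> \<Delta>\<close> _ i0'(1) \<open>m > 0\<close>] by simp
  qed
  then have "p s (opt s) k = 0" if "k \<in> K" for k
    using that \<open>finite K\<close> by (simp add: m_def Q_def sum_nonneg_eq_0_iff)
  then show ?thesis
    using that[of s "opt s"] slt opt(1)[of s] by (auto simp: \<Delta>_def p_def)
qed

section \<open>Sarkaria's trick and regular polygons\<close>

text \<open>To point \<open>i\<close> and part \<open>j\<close> belongs the vector of all
  \<open>\<Psi> k\<close> evaluated at the sequence with \<open>y i\<close> in position
  \<open>j\<close> and 0 elsewhere. The \<open>r\<close> vectors of one point add up to the image of
  a constant sequence, which is zero, so each point is a colour. Linearity turns a rainbow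
  combination into \<open>\<Psi> k\<close> of the sequence of part sums. Sequences live on
  \<open>nat\<close>, which is why constant ones are cut off to 0 from \<open>r\<close> on.\<close>

lemma sarkaria:
  fixes y :: "nat \<Rightarrow> 'b::real_vector" and \<Psi> :: "'k \<Rightarrow> (nat \<Rightarrow> 'b) \<Rightarrow> real"
  assumes "finite K" "card K < N" "r > 0"
    and lin: "\<And>k (c :: nat \<Rightarrow> real) (F :: nat \<Rightarrow> nat \<Rightarrow> 'b) I. k \<in> K \<Longrightarrow> finite I \<Longrightarrow>
      \<Psi> k (\<lambda>l. \<Sum>i\<in>I. c i *\<^sub>R F i l) = (\<Sum>i\<in>I. c i * \<Psi> k (F i))"
    and const: "\<And>k a. k \<in> K \<Longrightarrow> \<Psi> k (\<lambda>l. if l < r then a else 0) = 0"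
  obtains s \<nu> where "\<And>i. i < N \<Longrightarrow> s i < r" "\<And>i. i < N \<Longrightarrow> 0 \<le> \<nu> i" "(\<Sum>i<N. \<nu> i) = 1"
    "\<And>k. k \<in> K \<Longrightarrow> \<Psi> k (\<lambda>l. \<Sum>i | i < N \<and> s i = l. \<nu> i *\<^sub>R y i) = 0"
proof -
  define w where "w i j k = \<Psi> k (\<lambda>l. if l = j then y i else 0)" for i j k
  have zero: "(\<Sum>j<r. w i j k) = 0" if "k \<in> K" for i k
  proof -
    have "(\<Sum>j<r. w i j k) = \<Psi> k (\<lambda>l. \<Sum>j<r. 1 *\<^sub>R (if l = j then y i else 0))"
      using lin[OF that, of "{..<r}" "\<lambda>_. 1" "\<lambda>j l. if l = j then y i else 0"] by (simp add: w_def)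
    also have "(\<lambda>l. \<Sum>j<r. 1 *\<^sub>R (if l = j then y i else 0)) = (\<lambda>l. if l < r then y i else 0)"
      by auto
    finally show ?thesis using const[OF that] by simp
  qed
  obtain s \<nu> where s: "\<And>i. i < N \<Longrightarrow> s i < r" "\<And>i. i < N \<Longrightarrow> 0 \<le> \<nu> i" "(\<Sum>i<N. \<nu> i) = 1"
    and eq: "\<And>k. k \<in> K \<Longrightarrow> (\<Sum>i<N. \<nu> i * w i (s i) k) = 0"
    using colourful_caratheodory[of K N r w, OF assms(1-3) zero] by blast
  have "\<Psi> k (\<lambda>l. \<Sum>i | i < N \<and> s i = l. \<nu> i *\<^sub>R y i) = 0" if "k \<in> K" for k
  proof -
    have "(\<lambda>l. \<Sum>i<N. \<nu> i *\<^sub>R (if l = s i then y i else 0)) = (\<lambda>l. \<Sum>i | i < N \<and> s i = l. \<nu> i *\<^sub>R y i)"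
      by (rule ext, rule sum.mono_neutral_cong_right) auto
    then show ?thesis
      using eq[OF that] lin[OF that, of "{..<N}" \<nu> "\<lambda>i l. if l = s i then y i else 0"]
      by (simp add: w_def)
  qed
  then show ?thesis using that s by blast
qed

text \<open>The bound counts real functionals: \<open>r - 2\<close> complex recurrences for each of
  \<open>h\<close> planes, and \<open>r - 1\<close> equalities of neighbouring entries for each
  vector in \<open>B\<close>. \<open>X\<close> and \<open>Z\<close> are bound by equations to keep
  the recurrence readable; reflexivity instantiates them.\<close>

lemma sarkaria_recurrences:
  fixes y :: "nat \<Rightarrow> 'b::real_inner" and u v :: "nat \<Rightarrow> 'b" and z :: complex
  assumes "finite B" "2 * (h * (r - 2)) + card B * (r - 1) < N" "r \<ge> 2"
  obtains s \<nu> where "\<And>i. i < N \<Longrightarrow> s i < r" "\<And>i. i < N \<Longrightarrow> 0 \<le> \<nu> i" "(\<Sum>i<N. \<nu> i) = 1"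
    "\<And>b l. b \<in> B \<Longrightarrow> Suc l < r \<Longrightarrow>
       (\<Sum>i | i < N \<and> s i = Suc l. \<nu> i *\<^sub>R y i) \<bullet> b = (\<Sum>i | i < N \<and> s i = l. \<nu> i *\<^sub>R y i) \<bullet> b"
    "\<And>m l X Z. m < h \<Longrightarrow> Suc (Suc l) < r \<Longrightarrow>
       X = (\<lambda>l. \<Sum>i | i < N \<and> s i = l. \<nu> i *\<^sub>R y i) \<Longrightarrow>
       Z = (\<lambda>l. Complex (X l \<bullet> u m) (X l \<bullet> v m)) \<Longrightarrow>
       Z (Suc (Suc l)) - (1 + z) * Z (Suc l) + z * Z l = 0"
proof -
  define Z where "Z m x = Complex (x \<bullet> u m) (x \<bullet> v m)" for m x
  have Zlin: "Z m (\<Sum>i\<in>I. c i *\<^sub>R F i) = (\<Sum>i\<in>I. c i *\<^sub>R Z m (F i))" for m I c and F :: "nat \<Rightarrow> 'b"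
    by (simp add: Z_def complex_eq_iff inner_sum_left)
  define R where "R m l X = Z m (X (Suc (Suc l))) - (1 + z) * Z m (X (Suc l)) + z * Z m (X l)" for m l X
  have Rlin: "R m l (\<lambda>l. \<Sum>i\<in>I. c i *\<^sub>R F i l) = (\<Sum>i\<in>I. c i *\<^sub>R R m l (F i))"
    for m l I c and F :: "nat \<Rightarrow> nat \<Rightarrow> 'b"
    unfolding R_def Zlin sum_distrib_left sum_subtractf[symmetric] sum.distrib[symmetric]
    by (intro sum.cong refl) (simp add: complex_eq_iff algebra_simps)
  \<comment> \<open>The boolean chooses between real and imaginary part of a recurrence.\<close>
  define \<Psi> :: "(nat \<times> nat \<times> bool) + ('b \<times> nat) \<Rightarrow> (nat \<Rightarrow> 'b) \<Rightarrow> real" where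
    "\<Psi> k X = (case k of Inl (m, l, re) \<Rightarrow> (if re then Re (R m l X) else Im (R m l X))
                      | Inr (b, l) \<Rightarrow> (X (Suc l) - X l) \<bullet> b)" for k X
  define K where "K = ({..<h} \<times> {..<r-2} \<times> (UNIV :: bool set)) <+> (B \<times> {..<r-1})"
  have K: "finite K" "card K < N"
    using assms by (auto simp: K_def card_Plus card_cartesian_product)
  have lin: "\<Psi> k (\<lambda>l. \<Sum>i\<in>I. c i *\<^sub>R F i l) = (\<Sum>i\<in>I. c i * \<Psi> k (F i))"
    for k I and c :: "nat \<Rightarrow> real" and F
  proof (cases k)
    case (Inl a)
    then show ?thesis unfolding \<Psi>_def by (cases a) (simp add: Rlin[where c = c and F = F and I = I])
  next
    case (Inr a)
    then show ?thesis
      by (cases a) (auto simp: \<Psi>_def inner_diff_left inner_sum_left sum_subtractf right_diff_distrib)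
  qed
  \<comment> \<open>The coefficients 1, \<open>- (1 + z)\<close> and \<open>z\<close> add up to 0,
    and the indices in \<open>K\<close> keep all entries involved below the cut-off
    \<open>r\<close>.\<close>
  have const: "\<Psi> k (\<lambda>l. if l < r then a else 0) = 0" if "k \<in> K" for k a
    using that \<open>r \<ge> 2\<close> by (auto simp: \<Psi>_def K_def R_def algebra_simps)
  obtain s \<nu> where s: "\<And>i. i < N \<Longrightarrow> s i < r" "\<And>i. i < N \<Longrightarrow> 0 \<le> \<nu> i" "(\<Sum>i<N. \<nu> i) = 1"
    and eq: "\<And>k. k \<in> K \<Longrightarrow> \<Psi> k (\<lambda>l. \<Sum>i | i < N \<and> s i = l. \<nu> i *\<^sub>R y i) = 0"
    using sarkaria[of K N r \<Psi> y, OF K _ lin const] \<open>r \<ge> 2\<close> by auto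
  define X where "X = (\<lambda>l. \<Sum>i | i < N \<and> s i = l. \<nu> i *\<^sub>R y i)"
  have real: "X (Suc l) \<bullet> b = X l \<bullet> b" if "b \<in> B" "Suc l < r" for b l
  proof -
    have "Inr (b, l) \<in> K" using that by (auto simp: K_def)
    from eq[OF this] show ?thesis by (simp add: \<Psi>_def X_def[symmetric] inner_diff_left)
  qed
  have cplx: "R m l X = 0" if "m < h" "Suc (Suc l) < r" for m l
  proof -
    have "Inl (m, l, True) \<in> K" "Inl (m, l, False) \<in> K" using that by (auto simp: K_def)
    from this[THEN eq] show ?thesis by (simp add: \<Psi>_def X_def[symmetric] complex_eq_iff)
  qed
  show ?thesis
  proof (rule that[of s \<nu>])
    fix m l X' Z' assume "m < h" "Suc (Suc l) < r" "X' = (\<lambda>l. \<Sum>i | i < N \<and> s i = l. \<nu> i *\<^sub>R y i)"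
      "Z' = (\<lambda>l. Complex (X' l \<bullet> u m) (X' l \<bullet> v m))"
    then show "Z' (Suc (Suc l)) - (1 + z) * Z' (Suc l) + z * Z' l = 0"
      using cplx[of m l] by (simp add: R_def Z_def X_def)
  qed (use s real in \<open>auto simp only: X_def\<close>)
qed

text \<open>As the characteristic polynomial is (X - 1)(X - z), consecutive differences form a
  geometric sequence of ratio \<open>z\<close>; summing it needs
  \<open>z \<noteq> 1\<close>.\<close>

lemma linear_recurrence_roots_1_z:
  fixes Z :: "nat \<Rightarrow> 'a::field"
  assumes rec: "\<And>l. Suc (Suc l) < r \<Longrightarrow> Z (Suc (Suc l)) - (1 + z) * Z (Suc l) + z * Z l = 0"
    and "z \<noteq> 1"
  shows "\<exists>\<alpha> \<beta>. \<forall>l<r. Z l = \<alpha> + \<beta> * z ^ l"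
proof -
  define \<beta> where "\<beta> = (Z 1 - Z 0) / (z - 1)"
  have diff: "Suc l < r \<Longrightarrow> Z (Suc l) - Z l = z ^ l * (Z 1 - Z 0)" for l
  proof (induction l)
    case (Suc l)
    have "Z (Suc (Suc l)) - Z (Suc l) = z * (Z (Suc l) - Z l)"
      using rec[OF Suc.prems] by (simp add: algebra_simps)
    then show ?case using Suc by simp
  qed simp
  have "l < r \<Longrightarrow> Z l = (Z 0 - \<beta>) + \<beta> * z ^ l" for l
  proof (induction l)
    case (Suc l)
    have "Z 1 - Z 0 = \<beta> * (z - 1)" using \<open>z \<noteq> 1\<close> by (simp add: \<beta>_def)
    then have "Z (Suc l) - Z l = z ^ l * (\<beta> * (z - 1))" using diff[OF Suc.prems] by metis
    then show ?case using Suc by (simp add: algebra_simps)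
  qed simp
  then show ?thesis by blast
qed

section \<open>Roots of unity and regular polygons\<close>

lemma cis_root_pow: "cis (2 * pi / real r) ^ l = cis (2 * pi * real l / real r)"
  unfolding Complex.DeMoivre by (rule arg_cong[of _ _ cis]) simp

lemma cis_root_inj: "inj_on (\<lambda>j. cis (2 * pi * real j / real r)) {..<r}"
proof (cases "r = 0")
  case False
  then show ?thesis using bij_betw_roots_unity[of r]
    by (auto simp: bij_betw_def cis_conv_exp mult_ac)
qed simp

lemma step_constant:
  fixes f :: "nat \<Rightarrow> 'a"
  assumes "\<And>l. Suc l < r \<Longrightarrow> f (Suc l) = f l" "l < r"
  shows "f l = f 0"
  using assms(2) by (induction l) (use assms(1) in auto)

lemma combination_orthonormal_pairs:
  fixes u v :: "nat \<Rightarrow> 'a::real_inner" and h :: nat and f g :: "nat \<Rightarrow> real"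
  assumes uu: "\<And>m m'. m < h \<Longrightarrow> m' < h \<Longrightarrow> u m \<bullet> u m' = (if m = m' then 1 else 0)"
    and vv: "\<And>m m'. m < h \<Longrightarrow> m' < h \<Longrightarrow> v m \<bullet> v m' = (if m = m' then 1 else 0)"
    and uv: "\<And>m m'. m < h \<Longrightarrow> m' < h \<Longrightarrow> u m \<bullet> v m' = 0"
    and p: "p = (\<Sum>m<h. f m *\<^sub>R u m + g m *\<^sub>R v m)"
  shows "m < h \<Longrightarrow> p \<bullet> u m = f m" and "m < h \<Longrightarrow> p \<bullet> v m = g m"
    and "p \<bullet> p = (\<Sum>m<h. (f m)\<^sup>2 + (g m)\<^sup>2)"
    and "\<And>f' g'. p \<bullet> (\<Sum>m<h. f' m *\<^sub>R u m + g' m *\<^sub>R v m) = (\<Sum>m<h. f m * f' m + g m * g' m)"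
proof -
  have vu: "v m \<bullet> u m' = 0" if "m < h" "m' < h" for m m' using uv[OF that(2,1)] by (simp add: inner_commute)
  have pu: "p \<bullet> u m = f m" if "m < h" for m
  proof -
    have "p \<bullet> u m = (\<Sum>k<h. if k = m then f k else 0)"
      unfolding p inner_sum_left using that uu vu
      by (intro sum.cong refl) (auto simp: inner_add_left)
    then show ?thesis using that by simp
  qed
  have pv: "p \<bullet> v m = g m" if "m < h" for m
  proof -
    have "p \<bullet> v m = (\<Sum>k<h. if k = m then g k else 0)"
      unfolding p inner_sum_left using that vv uv
      by (intro sum.cong refl) (auto simp: inner_add_left)
    then show ?thesis using that by simp
  qed
  show "m < h \<Longrightarrow> p \<bullet> u m = f m" "m < h \<Longrightarrow> p \<bullet> v m = g m" using pu pv by auto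
  show pq: "p \<bullet> (\<Sum>m<h. f' m *\<^sub>R u m + g' m *\<^sub>R v m) = (\<Sum>m<h. f m * f' m + g m * g' m)" for f' g'
    unfolding inner_sum_right by (intro sum.cong refl) (simp add: inner_add_right pu pv mult.commute)
  show "p \<bullet> p = (\<Sum>m<h. (f m)\<^sup>2 + (g m)\<^sup>2)"
    using pq[of f g] unfolding p[symmetric] by (simp add: power2_eq_square)
qed

text \<open>Sarkaria's trick is applied to the lifted points \<open>(a i, 1)\<close>. In each plane
  the part sums follow \<alpha> + \<beta> z^j, and they are constant along \<open>B\<close>. With
  \<open>v m\<close> as \<i> times \<open>u m\<close>, the vector \<open>q\<close> is \<i> times
  \<open>p\<close>, whence the orthogonality and the equal length. The degenerate outcome
  \<open>p = 0\<close> remains possible here and is excluded later by genericity.\<close>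

lemma polygon_configuration:
  fixes a u v :: "nat \<Rightarrow> 'a::euclidean_space"
  assumes "finite B" "2 * (h * (r - 2)) + (card B + 1) * (r - 1) < N" "r \<ge> 2"
    and uu: "\<And>m m'. m < h \<Longrightarrow> m' < h \<Longrightarrow> u m \<bullet> u m' = (if m = m' then 1 else 0)"
    and vv: "\<And>m m'. m < h \<Longrightarrow> m' < h \<Longrightarrow> v m \<bullet> v m' = (if m = m' then 1 else 0)"
    and uv: "\<And>m m'. m < h \<Longrightarrow> m' < h \<Longrightarrow> u m \<bullet> v m' = 0"
    and B: "\<And>b m. b \<in> B \<Longrightarrow> m < h \<Longrightarrow> b \<bullet> u m = 0" "\<And>b m. b \<in> B \<Longrightarrow> m < h \<Longrightarrow> b \<bullet> v m = 0"
    and span: "span (B \<union> u ` {..<h} \<union> v ` {..<h}) = UNIV"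
  obtains s \<nu> c p q \<beta> where "\<And>i. i < N \<Longrightarrow> s i < r" "\<And>i. i < N \<Longrightarrow> 0 \<le> \<nu> i"
    "\<And>j. j < r \<Longrightarrow> (\<Sum>i | i < N \<and> s i = j. \<nu> i) = 1"
    "\<And>j. j < r \<Longrightarrow> (\<Sum>i | i < N \<and> s i = j. \<nu> i *\<^sub>R a i) =
        c + (cos (2 * pi * real j / real r) *\<^sub>R p + sin (2 * pi * real j / real r) *\<^sub>R q)"
    "p = (\<Sum>m<h. Re (\<beta> m) *\<^sub>R u m + Im (\<beta> m) *\<^sub>R v m)"
    "q = (\<Sum>m<h. - Im (\<beta> m) *\<^sub>R u m + Re (\<beta> m) *\<^sub>R v m)"
    "p \<bullet> q = 0" "p \<bullet> p = q \<bullet> q"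
proof -
  define z where "z = cis (2 * pi / real r)"
  have "z \<noteq> 1"
    using inj_onD[OF cis_root_inj[of r], of 1 0] \<open>r \<ge> 2\<close> by (auto simp: z_def)
  \<comment> \<open>the vector \<open>(0, 1)\<close> reads off the total weight of a part\<close>
  define B' where "B' = insert (0, 1) ((\<lambda>b. (b, 0::real)) ` B)"
  have "card B' \<le> card B + 1" using \<open>finite B\<close> card_image_le[of B "\<lambda>b. (b, 0::real)"]
    by (auto simp: B'_def card_insert_if)
  then have "card B' * (r - 1) \<le> (card B + 1) * (r - 1)" by (rule mult_le_mono1)
  then have B': "finite B'" "2 * (h * (r - 2)) + card B' * (r - 1) < N"
    using assms(1,2) by (auto simp: B'_def)
  obtain s \<nu> where s: "\<And>i. i < N \<Longrightarrow> s i < r" "\<And>i. i < N \<Longrightarrow> 0 \<le> \<nu> i" "(\<Sum>i<N. \<nu> i) = 1"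
    and real: "\<And>b l. b \<in> B' \<Longrightarrow> Suc l < r \<Longrightarrow>
       (\<Sum>i | i < N \<and> s i = Suc l. \<nu> i *\<^sub>R (a i, 1::real)) \<bullet> b = (\<Sum>i | i < N \<and> s i = l. \<nu> i *\<^sub>R (a i, 1)) \<bullet> b"
    and cplx: "\<And>m l X Z. m < h \<Longrightarrow> Suc (Suc l) < r \<Longrightarrow>
       X = (\<lambda>l. \<Sum>i | i < N \<and> s i = l. \<nu> i *\<^sub>R (a i, 1::real)) \<Longrightarrow>
       Z = (\<lambda>l. Complex (X l \<bullet> (u m, 0)) (X l \<bullet> (v m, 0))) \<Longrightarrow>
       Z (Suc (Suc l)) - (1 + z) * Z (Suc l) + z * Z l = 0"
    by (rule sarkaria_recurrences[OF B' \<open>r \<ge> 2\<close>, of "\<lambda>i. (a i, 1)" "\<lambda>m. (u m, 0)" "\<lambda>m. (v m, 0)" z],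
        rule that, assumption+)
  define W where "W l = (\<Sum>i | i < N \<and> s i = l. \<nu> i)" for l
  define Y where "Y l = (\<Sum>i | i < N \<and> s i = l. \<nu> i *\<^sub>R a i)" for l
  have XW: "(\<Sum>i | i < N \<and> s i = l. \<nu> i *\<^sub>R (a i, 1::real)) = (Y l, W l)" for l
    unfolding Y_def W_def by (simp add: prod_eq_iff fst_sum snd_sum)
  have W0: "W l = W 0" if "l < r" for l
    using that real[of "(0, 1)", unfolded XW] by (intro step_constant[of r W]) (simp_all add: B'_def inner_prod_def)
  have "(\<Sum>l<r. W l) = 1"
    unfolding W_def s(3)[symmetric] using sum.group[of "{..<N}" "{..<r}" s \<nu>] s(1) by auto
  moreover have "(\<Sum>l<r. W l) = (\<Sum>l<r. W 0)" by (intro sum.cong refl W0) simp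
  ultimately have "real r * W 0 = 1" by simp
  then have W: "real r * W l = 1" if "l < r" for l using W0[OF that] by metis
  \<comment> \<open>Every part has weight 1/r, so scaling by \<open>r\<close> turns the part sums
    into convex combinations.\<close>
  define x where "x l = real r *\<^sub>R Y l" for l
  have xb: "x l \<bullet> b = x 0 \<bullet> b" if "b \<in> B" "l < r" for b l
    using that real[of "(b, 0)", unfolded XW]
    by (intro step_constant[of r "\<lambda>l. x l \<bullet> b"]) (simp_all add: B'_def inner_prod_def x_def)
  define C where "C m l = Complex (x l \<bullet> u m) (x l \<bullet> v m)" for m l
  have "\<exists>\<alpha> \<beta>. \<forall>l<r. C m l = \<alpha> + \<beta> * z ^ l" if "m < h" for m
  proof (rule linear_recurrence_roots_1_z[OF _ \<open>z \<noteq> 1\<close>])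
    fix l assume l: "Suc (Suc l) < r"
    define Z where "Z l = Complex (Y l \<bullet> u m) (Y l \<bullet> v m)" for l
    have "Z (Suc (Suc l)) - (1 + z) * Z (Suc l) + z * Z l = 0"
      using cplx[OF \<open>m < h\<close> l refl refl, unfolded XW] by (simp add: inner_prod_def Z_def)
    moreover have CZ: "C m l = of_nat r * Z l" for l
      by (simp add: complex_eq_iff x_def Z_def C_def)
    have "C m (Suc (Suc l)) - (1 + z) * C m (Suc l) + z * C m l
      = of_nat r * (Z (Suc (Suc l)) - (1 + z) * Z (Suc l) + z * Z l)"
      unfolding CZ by (simp add: algebra_simps)
    ultimately show "C m (Suc (Suc l)) - (1 + z) * C m (Suc l) + z * C m l = 0" by simp
  qed
  then obtain \<alpha> \<beta> where \<beta>: "\<And>m l. m < h \<Longrightarrow> l < r \<Longrightarrow> C m l = \<alpha> m + \<beta> m * z ^ l"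
    by (metis (no_types))
  define p where "p = (\<Sum>m<h. Re (\<beta> m) *\<^sub>R u m + Im (\<beta> m) *\<^sub>R v m)"
  \<comment> \<open>Real and imaginary part of \<beta>(cos + \<i> sin) are Re \<beta> cos - Im
    \<beta> sin and Im \<beta> cos + Re \<beta> sin: the cosine terms form \<open>p\<close>, the
    sine terms \<open>q\<close>.\<close>
  define q where "q = (\<Sum>m<h. - Im (\<beta> m) *\<^sub>R u m + Re (\<beta> m) *\<^sub>R v m)"
  have pi: "p \<bullet> u m = Re (\<beta> m)" "p \<bullet> v m = Im (\<beta> m)" if "m < h" for m
    by (rule combination_orthonormal_pairs(1,2)[OF uu vv uv p_def that]; assumption)+
  have qi: "q \<bullet> u m = - Im (\<beta> m)" "q \<bullet> v m = Re (\<beta> m)" if "m < h" for m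
    by (rule combination_orthonormal_pairs(1,2)[OF uu vv uv q_def that]; assumption)+
  have pqB: "p \<bullet> b = 0" "q \<bullet> b = 0" if "b \<in> B" for b
    using B[OF that] unfolding p_def q_def inner_sum_left
    by (auto intro!: sum.neutral simp: inner_add_right inner_diff_right inner_commute[of _ b])
  \<comment> \<open>At \<open>j = 0\<close> the trigonometric term equals \<open>p\<close>, so the
    centre must be \<open>x 0 - p\<close>. The difference \<open>D\<close> of both sides is
    orthogonal to a spanning set, hence to itself.\<close>
  have x: "x j = (x 0 - p) + (cos (2 * pi * real j / real r) *\<^sub>R p + sin (2 * pi * real j / real r) *\<^sub>R q)"
    (is "_ = _ + (?c *\<^sub>R p + ?s *\<^sub>R q)") if "j < r" for j
  proof -
    define D where "D = x j - ((x 0 - p) + (?c *\<^sub>R p + ?s *\<^sub>R q))"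
    have zj: "z ^ j = Complex ?c ?s" by (simp add: z_def cis_root_pow complex_eq_iff)
    have Dy: "D \<bullet> y = 0" if y: "y \<in> B \<union> u ` {..<h} \<union> v ` {..<h}" for y
    proof -
      consider "y \<in> B" | m where "m < h" "y = u m" | m where "m < h" "y = v m" using y by blast
      then show ?thesis
      proof cases
        case 1
        then show ?thesis using xb[OF 1 \<open>j < r\<close>] pqB[OF 1]
          by (simp add: D_def inner_diff_left inner_add_left)
      next
        case 2
        then show ?thesis using \<beta>[OF 2(1) \<open>j < r\<close>] \<beta>[OF 2(1), of 0] \<open>j < r\<close> pi[OF 2(1)] qi[OF 2(1)]
          by (simp add: D_def C_def inner_diff_left inner_add_left zj complex_eq_iff)
      next
        case 3
        then show ?thesis using \<beta>[OF 3(1) \<open>j < r\<close>] \<beta>[OF 3(1), of 0] \<open>j < r\<close> pi[OF 3(1)] qi[OF 3(1)]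
          by (simp add: D_def C_def inner_diff_left inner_add_left zj complex_eq_iff)
      qed
    qed
    have "D \<in> span (B \<union> u ` {..<h} \<union> v ` {..<h})" unfolding span by (rule UNIV_I)
    then have "orthogonal D D"
      by (rule orthogonal_to_span) (simp only: orthogonal_def Dy)
    then show ?thesis by (simp add: D_def orthogonal_def)
  qed
  define \<mu> where "\<mu> i = real r * \<nu> i" for i
  have nonneg: "0 \<le> \<mu> i" if "i < N" for i using s(2)[OF that] by (simp add: \<mu>_def)
  have sum1: "(\<Sum>i | i < N \<and> s i = j. \<mu> i) = 1" if "j < r" for j
    using W[OF that] by (simp add: W_def \<mu>_def sum_distrib_left)
  have eq: "(\<Sum>i | i < N \<and> s i = j. \<mu> i *\<^sub>R a i) =
      (x 0 - p) + (cos (2 * pi * real j / real r) *\<^sub>R p + sin (2 * pi * real j / real r) *\<^sub>R q)" if "j < r" for j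
  proof -
    have "(\<Sum>i | i < N \<and> s i = j. \<mu> i *\<^sub>R a i) = x j"
      by (simp add: x_def Y_def \<mu>_def scaleR_sum_right)
    also note x[OF that]
    finally show ?thesis .
  qed
  have "p \<bullet> p = (\<Sum>m<h. (Re (\<beta> m))\<^sup>2 + (Im (\<beta> m))\<^sup>2)"
    by (rule combination_orthonormal_pairs(3)[OF uu vv uv p_def])
  moreover have "q \<bullet> q = (\<Sum>m<h. (- Im (\<beta> m))\<^sup>2 + (Re (\<beta> m))\<^sup>2)"
    by (rule combination_orthonormal_pairs(3)[OF uu vv uv q_def])
  ultimately have pp: "p \<bullet> p = q \<bullet> q" by (simp add: add.commute)
  have "p \<bullet> q = (\<Sum>m<h. Re (\<beta> m) * - Im (\<beta> m) + Im (\<beta> m) * Re (\<beta> m))"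
    unfolding q_def by (rule combination_orthonormal_pairs(4)[OF uu vv uv p_def])
  then have pq: "p \<bullet> q = 0" by (simp add: mult.commute)
  show ?thesis by (rule that[OF s(1) nonneg sum1 eq p_def q_def pq pp])
qed

text \<open>Dividing \<open>p\<close> and \<open>q\<close> by their common length gives the
  orthonormal frame, with that length as radius. The vertices are distinct because pairing with
  \<open>p\<close> and \<open>q\<close> recovers cosine and sine.\<close>

lemma regular_gon_vertices_cos_sin:
  fixes c p q :: "real^'n"
  assumes "p \<noteq> 0" "p \<bullet> q = 0" "p \<bullet> p = q \<bullet> q"
    and x: "\<And>j. j < r \<Longrightarrow>
        x j = c + (cos (2 * pi * real j / real r) *\<^sub>R p + sin (2 * pi * real j / real r) *\<^sub>R q)"
  shows "regular_gon_vertices r (x ` {..<r})" and "bij_betw x {..<r} (x ` {..<r})"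
proof -
  have n: "norm p > 0" "norm q = norm p" using assms by (auto simp: norm_eq_sqrt_inner)
  show "regular_gon_vertices r (x ` {..<r})"
    unfolding regular_gon_vertices_def
  proof (intro exI conjI)
    show "norm p > 0" "norm (p /\<^sub>R norm p) = 1" "norm (q /\<^sub>R norm p) = 1"
      "(p /\<^sub>R norm p) \<bullet> (q /\<^sub>R norm p) = 0" using n assms by auto
    show "x ` {..<r} = (\<lambda>j. c + norm p *\<^sub>R (cos (2 * pi * real j / real r) *\<^sub>R (p /\<^sub>R norm p)
        + sin (2 * pi * real j / real r) *\<^sub>R (q /\<^sub>R norm p))) ` {..<r}"
      using n by (intro image_cong refl) (simp add: x scaleR_add_right field_simps)
  qed
  have "inj_on x {..<r}"
  proof (rule inj_onI)
    fix i j assume ij: "i \<in> {..<r}" "j \<in> {..<r}" "x i = x j"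
    have *: "cos (2 * pi * real l / real r) * (p \<bullet> p) = (x l - c) \<bullet> p"
      "sin (2 * pi * real l / real r) * (p \<bullet> p) = (x l - c) \<bullet> q" if "l < r" for l
      using that x assms(2,3) by (auto simp: inner_add_left inner_commute[of q p])
    have "p \<bullet> p \<noteq> 0" using \<open>p \<noteq> 0\<close> by simp
    moreover have "cos (2 * pi * real i / real r) * (p \<bullet> p) = cos (2 * pi * real j / real r) * (p \<bullet> p)"
      "sin (2 * pi * real i / real r) * (p \<bullet> p) = sin (2 * pi * real j / real r) * (p \<bullet> p)"
      using *[of i] *[of j] ij by simp_all
    ultimately have "cos (2 * pi * real i / real r) = cos (2 * pi * real j / real r)"
      "sin (2 * pi * real i / real r) = sin (2 * pi * real j / real r)"
      by (simp_all only: mult_cancel_right simp_thms)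
    then show "i = j" using cis_root_inj[of r] ij by (auto simp: inj_on_def complex_eq_iff)
  qed
  then show "bij_betw x {..<r} (x ` {..<r})" by (rule inj_on_imp_bij_betw)
qed

section \<open>Fourier generic maps have no Tverberg partitions\<close>

definition cyclic_elt :: "nat \<Rightarrow> nat \<Rightarrow> int" where
  "cyclic_elt k = (\<lambda>i\<in>{..<1}. int k)"

definition cyclic_grp :: "nat \<Rightarrow> (nat \<Rightarrow> int) monoid" where
  "cyclic_grp r = cyclic_sum (Suc 0) (\<lambda>_. r)"

lemma cyclic_elt_0 [simp]: "cyclic_elt k 0 = int k"
  by (simp add: cyclic_elt_def)

lemma cyclic_elt_inject [simp]: "cyclic_elt k = cyclic_elt l \<longleftrightarrow> k = l"
proof
  assume "cyclic_elt k = cyclic_elt l"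
  then have "cyclic_elt k 0 = cyclic_elt l 0" by (rule fun_cong)
  then show "k = l" by simp
qed simp

text \<open>Elements of a one-factor product group are extensional functions on
  \<open>{..<1}\<close>, determined by their value at 0.\<close>

lemma carrier_cyclic_grp:
  assumes "r > 0"
  shows "carrier (cyclic_grp r) = cyclic_elt ` {..<r}"
proof -
  have C: "carrier (cyclic_grp r) = (\<Pi>\<^sub>E i\<in>{..<1}. {0..<int r})"
    using assms by (simp add: cyclic_grp_def cyclic_sum_def carrier_integer_mod_group)
  show ?thesis
  proof (intro equalityI subsetI)
    fix g assume "g \<in> cyclic_elt ` {..<r}"
    then obtain k where "k < r" "g = (\<lambda>i\<in>{..<1}. int k)" unfolding cyclic_elt_def by blast
    then show "g \<in> carrier (cyclic_grp r)" unfolding C by (simp add: restrict_PiE_iff)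
  next
    fix g assume "g \<in> carrier (cyclic_grp r)"
    then have g: "g 0 \<in> {0..<int r}" "\<And>i. i \<noteq> 0 \<Longrightarrow> g i = undefined" unfolding C by (auto simp: PiE_iff extensional_def)
    have "g i = cyclic_elt (nat (g 0)) i" for i
      using g(1) g(2)[of i] by (cases "i = 0") (simp_all add: cyclic_elt_def)
    then have "g = cyclic_elt (nat (g 0))" by (rule ext)
    moreover have "nat (g 0) < r" using g(1) by auto
    ultimately show "g \<in> cyclic_elt ` {..<r}" by blast
  qed
qed

lemma group_cyclic_grp: "group (cyclic_grp r)"
  by (simp add: cyclic_grp_def cyclic_sum_def)

lemma one_cyclic_grp: "\<one>\<^bsub>cyclic_grp r\<^esub> = cyclic_elt 0"
  by (simp add: cyclic_grp_def cyclic_sum_def cyclic_elt_def)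

lemma mult_cyclic_grp:
  "cyclic_elt k \<otimes>\<^bsub>cyclic_grp r\<^esub> cyclic_elt l = cyclic_elt ((k + l) mod r)"
  by (auto simp: cyclic_grp_def cyclic_sum_def cyclic_elt_def restrict_def fun_eq_iff zmod_int)

lemma ord_cyclic_grp_eq_2:
  assumes "0 < k" "k < r"
  shows "group.ord (cyclic_grp r) (cyclic_elt k) = 2 \<longleftrightarrow> 2 * k = r"
proof -
  let ?G = "cyclic_grp r"
  interpret G: group ?G by (rule group_cyclic_grp)
  have k: "cyclic_elt k \<in> carrier ?G" using assms by (auto simp: carrier_cyclic_grp)
  have sq: "cyclic_elt k [^]\<^bsub>?G\<^esub> (2::nat) = cyclic_elt (2 * k mod r)"
    using k by (simp add: numeral_2_eq_2 mult_cyclic_grp)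
  have "cyclic_elt k \<noteq> \<one>\<^bsub>?G\<^esub>" using assms by (simp add: one_cyclic_grp)
  then have "G.ord (cyclic_elt k) \<noteq> 1" using G.ord_eq_1[OF k] by simp
  then have "G.ord (cyclic_elt k) = 2 \<longleftrightarrow> G.ord (cyclic_elt k) dvd 2"
    by (metis dvd_refl prime_nat_iff two_is_prime_nat)
  also have "\<dots> \<longleftrightarrow> cyclic_elt (2 * k mod r) = \<one>\<^bsub>?G\<^esub>"
    using G.pow_eq_id[OF k, of 2] sq by simp
  also have "\<dots> \<longleftrightarrow> r dvd 2 * k"
    by (simp only: one_cyclic_grp cyclic_elt_inject dvd_eq_mod_eq_0)
  also have "\<dots> \<longleftrightarrow> 2 * k = r"
  proof
    \<comment> \<open>Since 0 < 2k < 2r, the only possible multiple of \<open>r\<close> is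
      \<open>r\<close> itself.\<close>
    assume "r dvd 2 * k"
    then obtain m where m: "2 * k = r * m" by blast
    then have "r * m < r * 2" using assms by linarith
    then have "m < 2" by (simp only: mult_less_cancel1)
    moreover have "0 < m" using m assms by (auto intro!: gr0I)
    ultimately have "0 < m" "m < 2" by auto
    then show "2 * k = r" using m by (simp add: less_2_cases_iff)
  qed auto
  finally show ?thesis .
qed

lemma inv_cyclic_grp:
  assumes "0 < k" "k < r"
  shows "inv\<^bsub>cyclic_grp r\<^esub> cyclic_elt k = cyclic_elt (r - k)"
proof (rule group.inv_equality[OF group_cyclic_grp])
  show "cyclic_elt (r - k) \<otimes>\<^bsub>cyclic_grp r\<^esub> cyclic_elt k = \<one>\<^bsub>cyclic_grp r\<^esub>"
    using assms by (simp only: mult_cyclic_grp one_cyclic_grp cyclic_elt_inject) simp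
  show "cyclic_elt k \<in> carrier (cyclic_grp r)"
    "cyclic_elt (r - k) \<in> carrier (cyclic_grp r)"
    using assms by (auto simp: carrier_cyclic_grp)
qed

text \<open>A full geometric sum over a nontrivial \<open>r\<close>-th root of unity. It makes the
  Fourier coefficients of a constant vanish at nonzero frequencies.\<close>

lemma sum_inverse_chi_eq_0:
  assumes "0 < k" "k < r"
  shows "(\<Sum>g\<in>carrier (cyclic_grp r). inverse (chi (Suc 0) (\<lambda>_. r) (cyclic_elt k) g)) = 0"
proof -
  define z where "z = inverse (zeta r ^ k)"
  have zeta: "zeta r = cis (2 * pi / real r)" by (simp add: zeta_def cis_conv_exp mult_ac)
  have "zeta r ^ r = 1" using assms by (simp add: zeta Complex.DeMoivre)
  then have "z ^ r = 1"
    by (simp add: z_def power_inverse) (metis mult.commute power_mult power_one)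
  moreover have "z \<noteq> 1"
  proof
    assume "z = 1"
    then have "zeta r ^ k = 1" by (simp add: z_def)
    then have "cis (2 * pi * real k / real r) = cis (2 * pi * real 0 / real r)"
      by (simp only: zeta cis_root_pow) simp
    from inj_onD[OF cis_root_inj this] show False using assms by auto
  qed
  moreover have "(\<Sum>g\<in>carrier (cyclic_grp r). inverse (chi (Suc 0) (\<lambda>_. r) (cyclic_elt k) g)) = (\<Sum>m<r. z ^ m)"
  proof -
    have "inverse (chi (Suc 0) (\<lambda>_. r) (cyclic_elt k) (cyclic_elt m)) = z ^ m" for m
      by (simp add: chi_def z_def power_int_def nat_mult_distrib power_mult power_inverse)
    then show ?thesis
      using assms by (simp add: carrier_cyclic_grp sum.reindex inj_on_def)
  qed
  ultimately show ?thesis by (simp add: sum_gp_strict)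
qed

lemma disjoint_simplex_faces:
  assumes "K \<inter> L = {}"
  shows "simplex_face M K \<inter> simplex_face M L = {}"
proof -
  have False if "t \<in> simplex_face M K" "t \<in> simplex_face M L" for t
  proof -
    have "t i = 0" for i using that assms by (cases "i \<in> K") (auto simp: simplex_face_def)
    then show False using that by (simp add: simplex_face_def standard_simplex_def)
  qed
  then show ?thesis by blast
qed

text \<open>At a Tverberg point the map is constant on the chosen points of the simplex, so all
  coefficients of nonzero frequency vanish. With d real coordinates, each carrying the frequencies
  \<open>H\<close>, one has 2|H| - |T| = r - 1 for both parities of \<open>r\<close>. The dimension
  threshold 2m - m' + |G| - 1 is then (d + 1)(r - 1), which exceeds \<open>N - 1\<close>.\<close>

lemma fourier_generic_no_tverberg:
  fixes a :: "nat \<Rightarrow> real^'n::finite"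
  assumes gen: "fourier_generic (N - 1) (\<lambda>t. \<Sum>i\<le>N - 1. t i *\<^sub>R a i)"
    and N: "N \<ge> 1" "N \<le> (r - 1) * (CARD('n) + 1)" and "r \<ge> 2"
    and p: "bij_betw p {..<CARD('n)} (UNIV :: 'n set)"
    and s: "\<And>i. i < N \<Longrightarrow> s i < r" and \<nu>: "\<And>i. i < N \<Longrightarrow> 0 \<le> \<nu> i"
    and sum1: "\<And>j. j < r \<Longrightarrow> (\<Sum>i | i < N \<and> s i = j. \<nu> i) = 1"
    and eq: "\<And>j. j < r \<Longrightarrow> (\<Sum>i | i < N \<and> s i = j. \<nu> i *\<^sub>R a i) = c"
  shows False
proof -
  let ?G = "cyclic_grp r" and ?d = "CARD('n)" and ?f = "\<lambda>t. \<Sum>i\<le>N - 1. t i *\<^sub>R a i"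
  define A where "A j = {i. i < N \<and> s i = j}" for j
  \<comment> \<open>one frequency from each pair \<open>\<plusminus>h\<close>\<close>
  define H where "H = cyclic_elt ` {1..r div 2}"
  define T where "T = {h \<in> H. group.ord ?G h = 2}"
  \<comment> \<open>\<open>t j\<close> holds the barycentric coordinates of the common point in the
    face spanned by part \<open>j\<close>; \<open>x\<close> re-indexes these by group
    elements.\<close>
  define t where "t j i = (if i \<in> A j then \<nu> i else 0)" for j i
  define x where "x g = t (nat (g 0))" for g :: "nat \<Rightarrow> int"
  have "?d \<ge> 1" by (simp add: Suc_leI)
  have atMost: "{..N - 1} = {..<N}" using N by auto
  have kr: "k < r" if "k \<in> {1..r div 2}" for k using that \<open>r \<ge> 2\<close> by auto
  have carrier: "carrier ?G = cyclic_elt ` {..<r}" using \<open>r \<ge> 2\<close> by (intro carrier_cyclic_grp) auto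
  have order: "order ?G = r" by (simp add: order_def carrier card_image inj_on_def)
  have cardH: "card H = r div 2" by (simp add: H_def card_image inj_on_def)
  have T: "T \<subseteq> (if even r then {cyclic_elt (r div 2)} else {})"
  proof
    fix h assume "h \<in> T"
    then obtain k where k: "k \<in> {1..r div 2}" "h = cyclic_elt k" "group.ord ?G h = 2"
      by (auto simp: T_def H_def)
    then have "2 * k = r" using kr[OF k(1)] ord_cyclic_grp_eq_2[of k r] by auto
    then show "h \<in> (if even r then {cyclic_elt (r div 2)} else {})" using k(2) by auto
  qed
  \<comment> \<open>For odd \<open>r\<close> nothing has order 2 and |H| = (r - 1)/2; for even
    \<open>r\<close> the single involution makes up for |H| = r/2.\<close>
  have "card T \<le> (if even r then 1 else 0)"
    using card_mono[OF _ T] by (auto split: if_splits)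
  then have cardT: "int r - 1 \<le> 2 * int (card H) - int (card T)"
    unfolding cardH by (auto split: if_splits elim!: evenE oddE)
  have adm: "admissible ?G 0 ?d (\<lambda>_. H)"
  proof -
    have "H \<subseteq> carrier ?G - {\<one>\<^bsub>?G\<^esub>}"
      unfolding carrier one_cyclic_grp using kr by (auto simp: H_def)
    moreover have "inv\<^bsub>?G\<^esub> h \<notin> H" if "h \<in> H" "group.ord ?G h \<noteq> 2" for h
    proof -
      obtain k where k: "k \<in> {1..r div 2}" "h = cyclic_elt k" using \<open>h \<in> H\<close> by (auto simp: H_def)
      have "2 * k \<noteq> r" using that(2) k kr[OF k(1)] ord_cyclic_grp_eq_2[of k r] by auto
      then have "r - k \<notin> {1..r div 2}" using k(1) by auto
      then show ?thesis using k kr[OF k(1)] by (auto simp: inv_cyclic_grp H_def)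
    qed
    ultimately show ?thesis by (simp add: admissible_def)
  qed
  have "int ?d * (int r - 1) \<le> int ?d * (2 * int (card H) - int (card T))"
    using cardT by (intro mult_left_mono) auto
  moreover have "int N \<le> int ?d * (int r - 1) + (int r - 1)"
  proof -
    have "int N \<le> int ((r - 1) * (?d + 1))" using N(2) by (simp only: of_nat_le_iff)
    also have "\<dots> = (int r - 1) * (int ?d + 1)" using \<open>r \<ge> 2\<close> by (simp only: of_nat_mult of_nat_add) simp
    finally show ?thesis by (simp add: algebra_simps)
  qed
  ultimately have bound: "int (N - 1) < 2 * (\<Sum>i<0 + ?d. int (card H))
      - (\<Sum>i = 0..<0 + ?d. int (card {h \<in> H. group.ord ?G h = 2})) + int (order ?G) - 1"
    using N by (simp add: order T_def[symmetric] of_nat_diff algebra_simps)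
  have face: "t j \<in> simplex_face (N - 1) (A j)" if "j < r" for j
  proof -
    have "(\<Sum>i\<le>N - 1. t j i) = (\<Sum>i\<in>A j. \<nu> i)"
      unfolding atMost t_def by (rule sum.mono_neutral_cong_right) (auto simp: A_def)
    then have 1: "(\<Sum>i\<le>N - 1. t j i) = 1" using sum1[OF that] by (simp add: A_def)
    have "finite (A j)" by (simp add: A_def)
    then have "\<nu> i \<le> 1" if "i \<in> A j" for i
      using member_le_sum[of i "A j" \<nu>] that \<nu> sum1[OF \<open>j < r\<close>] by (auto simp: A_def)
    then show ?thesis
      using 1 \<nu> N by (auto simp: simplex_face_def standard_simplex_def t_def A_def)
  qed
  have fx: "?f (t j) = c" if "j < r" for j
  proof -
    have "?f (t j) = (\<Sum>i\<in>A j. \<nu> i *\<^sub>R a i)"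
      unfolding atMost t_def by (rule sum.mono_neutral_cong_right) (auto simp: A_def)
    then show ?thesis using eq[OF that] by (simp add: A_def)
  qed
  have disj: "disjoint_support (N - 1) (carrier ?G) x"
    unfolding disjoint_support_def
  proof (intro exI[of _ "\<lambda>g. A (nat (g 0))"] conjI ballI)
    show "disjoint_family_on (\<lambda>g. simplex_face (N - 1) (A (nat (g 0)))) (carrier ?G)"
      unfolding disjoint_family_on_def carrier
      by (auto intro!: disjoint_simplex_faces simp: A_def)
  next
    fix g assume "g \<in> carrier ?G"
    then show "x g \<in> simplex_face (N - 1) (A (nat (g 0)))" "A (nat (g 0)) \<subseteq> {..N - 1}"
      using N face by (auto simp: carrier x_def A_def)
  qed
  have xface: "\<forall>g\<in>carrier ?G. x g \<in> simplex_face (N - 1) {..N - 1}"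
  proof
    fix g assume "g \<in> carrier ?G"
    then obtain j where "j < r" "x g = t j" by (auto simp: carrier x_def)
    then show "x g \<in> simplex_face (N - 1) {..N - 1}"
      using face by (auto simp: simplex_face_def standard_simplex_def)
  qed
  have coeff: "fourier_coeff (Suc 0) (\<lambda>_. r) (\<lambda>t. sigma_coord p 0 (?f t)) x i h = 0" if "h \<in> H" for i h
  proof -
    obtain k where k: "k \<in> {1..r div 2}" "h = cyclic_elt k" using \<open>h \<in> H\<close> by (auto simp: H_def)
    have "(\<Sum>g\<in>carrier ?G. sigma_coord p 0 (?f (x g)) i * inverse (chi (Suc 0) (\<lambda>_. r) h g))
        = (\<Sum>g\<in>carrier ?G. sigma_coord p 0 c i * inverse (chi (Suc 0) (\<lambda>_. r) h g))"
      using fx by (intro sum.cong refl) (auto simp only: carrier x_def cyclic_elt_0 nat_int lessThan_iff)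
    also have "\<dots> = 0"
      using sum_inverse_chi_eq_0[of k r] k kr[OF k(1)] by (simp add: sum_distrib_left[symmetric])
    finally show ?thesis unfolding fourier_coeff_def cyclic_grp_def[symmetric] by simp
  qed
  have "\<not> (\<exists>x. (\<forall>g \<in> carrier ?G. x g \<in> simplex_face (N - 1) {..N - 1}) \<and>
               disjoint_support (N - 1) (carrier ?G) x \<and>
               (\<forall>i < 0 + ?d. \<forall>h \<in> H.
                  fourier_coeff (Suc 0) (\<lambda>_. r) (\<lambda>t. sigma_coord p 0 (?f t)) x i h = 0))"
    using gen[unfolded fourier_generic_def, rule_format, of "Suc 0" "\<lambda>_. r" 0 ?d p "\<lambda>_. H" "{..N - 1}" "N - 1",
        folded cyclic_grp_def] bound adm \<open>r \<ge> 2\<close> \<open>?d \<ge> 1\<close> p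
    by simp
  then show False using disj xface coeff by blast
qed

section \<open>Almost all point sets have no Tverberg partitions\<close>

text \<open>Plays the role of the fact that a nonzero polynomial vanishes only on a null set: one
  good tuple suffices if goodness survives almost every change of a single coordinate. By induction
  almost all tuples whose new coordinate is frozen at \<open>x0 i\<close> are good; then that
  coordinate is released, and Fubini applies.\<close>

lemma AE_PiM_slices:
  fixes P :: "('i \<Rightarrow> 'a::euclidean_space) \<Rightarrow> bool"
  assumes "finite I" "Measurable.pred (PiM I (\<lambda>_. lborel)) P"
    and "\<And>x i. x \<in> (\<Pi>\<^sub>E i\<in>I. UNIV) \<Longrightarrow> i \<in> I \<Longrightarrow> P x \<Longrightarrow> AE y in lborel. P (x(i := y))"
    and "x0 \<in> (\<Pi>\<^sub>E i\<in>I. UNIV)" "P x0"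
  shows "AE x in PiM I (\<lambda>_. lborel). P x"
  using assms
proof (induction I arbitrary: P x0 rule: finite_induct)
  case empty
  then show ?case by (intro AE_I2) (auto simp: space_PiM)
next
  case (insert i I)
  interpret product_sigma_finite "\<lambda>_. lborel :: 'a measure"
    by (simp add: product_sigma_finite_def sigma_finite_lborel)
  let ?M = "\<lambda>J. PiM J (\<lambda>_. lborel :: 'a measure)"
  have P[measurable]: "Measurable.pred (?M (insert i I)) P" by fact
  have upd: "(\<lambda>x. x(i := c)) \<in> measurable (?M I) (?M (insert i I))" for c
    by (rule measurable_fun_upd[where J = I]) auto
  have "AE x in ?M I. P (x(i := x0 i))"
  proof (rule insert.IH)
    show "Measurable.pred (?M I) (\<lambda>x. P (x(i := x0 i)))"
      using measurable_compose[OF upd P] by simp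
  next
    fix x k assume x: "x \<in> (\<Pi>\<^sub>E i\<in>I. UNIV)" "k \<in> I" "P (x(i := x0 i))"
    have "x(i := x0 i) \<in> (\<Pi>\<^sub>E i\<in>insert i I. UNIV)" using x by (auto simp: PiE_iff extensional_def)
    then have "AE y in lborel. P (x(i := x0 i, k := y))"
      by (rule insert.prems(2)[OF _ insertI2[OF x(2)] x(3)])
    moreover have "x(i := x0 i, k := y) = x(k := y, i := x0 i)" for y
      using x(2) insert.hyps by (intro fun_upd_twist) auto
    ultimately show "AE y in lborel. P (x(k := y, i := x0 i))" by (simp only:)
  next
    \<comment> \<open>Resetting the value at \<open>i\<close> makes the witness extensional on the
      smaller index set.\<close>
    show "x0(i := undefined) \<in> (\<Pi>\<^sub>E i\<in>I. UNIV)"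
      using insert.prems(3) by (auto simp: PiE_iff extensional_def)
    show "P ((x0(i := undefined))(i := x0 i))" using insert.prems(4) by simp
  qed
  then have "AE x in ?M I. (\<integral>\<^sup>+ y. indicator {x. \<not> P x} (x(i := y)) \<partial>lborel) = 0"
  proof (rule AE_mp, intro AE_I2 impI)
    fix x assume x: "x \<in> space (?M I)" "P (x(i := x0 i))"
    have x': "x(i := c) \<in> (\<Pi>\<^sub>E i\<in>insert i I. UNIV)" for c
      using x(1) by (auto simp: space_PiM PiE_iff extensional_def)
    have "AE y in lborel. P (x(i := y))"
      using insert.prems(2)[OF x' insertI1 x(2)] by (simp only: fun_upd_upd)
    then have "(\<integral>\<^sup>+ y. indicator {x. \<not> P x} (x(i := y)) \<partial>lborel) = (\<integral>\<^sup>+ y. 0 \<partial>(lborel :: 'a measure))"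
      by (intro nn_integral_cong_AE) auto
    then show "(\<integral>\<^sup>+ y. indicator {x. \<not> P x} (x(i := y)) \<partial>lborel) = 0" by simp
  qed
  then have "(\<integral>\<^sup>+ x. (\<integral>\<^sup>+ y. indicator {x. \<not> P x} (x(i := y)) \<partial>lborel) \<partial>?M I) = (\<integral>\<^sup>+ x. 0 \<partial>?M I)"
    by (rule nn_integral_cong_AE)
  moreover have "integral\<^sup>N (?M (insert i I)) (indicator {x. \<not> P x})
      = (\<integral>\<^sup>+ x. (\<integral>\<^sup>+ y. indicator {x. \<not> P x} (x(i := y)) \<partial>lborel) \<partial>?M I)"
    by (rule product_nn_integral_insert) (use insert.hyps in \<open>measurable\<close>)
  ultimately show ?case
    by (subst AE_iff_nn_integral) simp_all
qed

text \<open>A proper affine subspace is closed with empty interior, so it is its own frontier, and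
  frontiers of convex sets are negligible.\<close>

lemma AE_not_in_affine:
  fixes S :: "'a::euclidean_space set"
  assumes "affine S" "a \<notin> S"
  shows "AE y in lborel. y \<notin> S"
proof -
  have "interior S = {}"
    using affine_hull_nonempty_interior[of S] assms hull_same[of affine S] by auto
  then have "frontier S = S" using affine_closed[OF assms(1)] by (simp add: frontier_def closure_closed)
  then have "negligible S" using negligible_convex_frontier[of S] affine_imp_convex[OF assms(1)] by simp
  then have "AE y in lebesgue. y \<notin> S" by (simp add: negligible_iff_null_sets AE_not_in)
  then show ?thesis by (simp add: AE_completion_iff)
qed

text \<open>The tube lemma shows that the complement is open.\<close>

lemma closed_compact_projection:
  fixes S :: "('a::topological_space \<times> 'b::topological_space) set"
  assumes "closed S" "compact K"
  shows "closed {x. \<exists>y\<in>K. (x, y) \<in> S}"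
proof -
  have "open (- {x. \<exists>y\<in>K. (x, y) \<in> S})"
  proof (subst open_subopen, intro ballI)
    fix x assume "x \<in> - {x. \<exists>y\<in>K. (x, y) \<in> S}"
    then have "{x} \<times> K \<subseteq> - S" by auto
    moreover have "open (- S)" using assms by auto
    ultimately obtain X where "x \<in> X" "open X" "X \<times> K \<subseteq> - S"
      using Elementary_Topology.tube_lemma[OF \<open>compact K\<close>] by metis
    then show "\<exists>T. open T \<and> x \<in> T \<and> T \<subseteq> - {x. \<exists>y\<in>K. (x, y) \<in> S}" by blast
  qed
  then show ?thesis by (simp add: closed_def)
qed

text \<open>Being linked is a linear dependence of the vectors attached to the points \<open>x i\<close> by Sarkaria's
  trick; unlike the existence of a Tverberg point it depends on
  no signs, so that its slices in a single point are proper affine subspaces or everything.\<close>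

definition linked :: "nat \<Rightarrow> (nat \<Rightarrow> nat set) \<Rightarrow> (nat \<Rightarrow> 'a::euclidean_space) \<Rightarrow> bool" where
  "linked r J x \<longleftrightarrow> (\<exists>\<nu>. (\<exists>C :: 'a \<times> real. \<forall>j<r. (\<Sum>i\<in>J j. \<nu> i *\<^sub>R (x i, 1)) = C) \<and>
                        (\<exists>j<r. \<exists>i\<in>J j. \<nu> i \<noteq> 0))"

text \<open>Dividing a dependence by its coefficient of largest modulus puts all coefficients into
  [-1, 1] and one of them at 1. The quantifier over dependences thus ranges over finitely many
  compact sets that exclude the zero dependence.\<close>

lemma linked_normalized:
  assumes "\<And>j. j < r \<Longrightarrow> finite (J j)"
  shows "linked r J x \<longleftrightarrow> (\<exists>i0\<in>\<Union>j<r. J j. \<exists>\<nu>\<in>{\<nu>. (\<forall>i. \<nu> i \<in> {-1..1}) \<and> \<nu> i0 = 1}.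
    \<forall>j\<in>{..<r}. (\<Sum>i\<in>J j. \<nu> i *\<^sub>R (x i, 1::real)) = (\<Sum>i\<in>J 0. \<nu> i *\<^sub>R (x i, 1)))" (is "_ \<longleftrightarrow> ?R")
proof
  assume "linked r J x"
  then obtain \<nu> C j1 i1 where \<nu>: "\<And>j. j < r \<Longrightarrow> (\<Sum>i\<in>J j. \<nu> i *\<^sub>R (x i, 1::real)) = C"
    "j1 < r" "i1 \<in> J j1" "\<nu> i1 \<noteq> 0" unfolding linked_def by blast
  let ?U = "\<Union>j<r. J j"
  have "finite ?U" "?U \<noteq> {}" using assms \<nu> by auto
  then obtain i0 where i0: "i0 \<in> ?U" "\<And>i. i \<in> ?U \<Longrightarrow> - \<bar>\<nu> i0\<bar> \<le> - \<bar>\<nu> i\<bar>"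
    using ex_is_arg_min_if_finite[of ?U "\<lambda>i. - \<bar>\<nu> i\<bar>"] unfolding is_arg_min_linorder by blast
  have "i1 \<in> ?U" using \<nu> by blast
  have "\<nu> i0 \<noteq> 0" using i0(2)[OF \<open>i1 \<in> ?U\<close>] \<nu>(4) by linarith
  \<comment> \<open>Coefficients outside all parts are set to 0, so that the bound holds at every
    index.\<close>
  define \<mu> where "\<mu> i = (if i \<in> ?U then \<nu> i / \<nu> i0 else 0)" for i
  have "\<mu> i \<in> {-1..1}" for i
  proof -
    have "\<bar>\<mu> i\<bar> \<le> 1" using i0(2)[of i] \<open>\<nu> i0 \<noteq> 0\<close> by (auto simp: \<mu>_def abs_divide)
    then show ?thesis by auto
  qed
  moreover have "\<mu> i0 = 1" using i0 \<open>\<nu> i0 \<noteq> 0\<close> by (simp add: \<mu>_def)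
  moreover have "(\<Sum>i\<in>J j. \<mu> i *\<^sub>R (x i, 1::real)) = (1 / \<nu> i0) *\<^sub>R C" if "j < r" for j
    unfolding \<nu>(1)[OF that, symmetric] scaleR_sum_right using that by (intro sum.cong refl) (auto simp: \<mu>_def)
  ultimately show ?R
    using i0(1) \<nu>(2) by (intro bexI[of _ i0] bexI[of _ \<mu>]) auto
next
  assume ?R
  then obtain i0 j0 \<nu> where "j0 < r" "i0 \<in> J j0" "\<nu> i0 = 1"
    and eq: "\<forall>j<r. (\<Sum>i\<in>J j. \<nu> i *\<^sub>R (x i, 1::real)) = (\<Sum>i\<in>J 0. \<nu> i *\<^sub>R (x i, 1))" by blast
  then have "\<exists>j<r. \<exists>i\<in>J j. \<nu> i \<noteq> 0" by (intro exI[of _ j0] conjI bexI[of _ i0]) auto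
  then show "linked r J x" using eq unfolding linked_def by blast
qed

text \<open>A finite union, over the index with coefficient 1, of projections of a closed set along
  a compact box. This supplies the measurability of being linked.\<close>

lemma closed_linked:
  fixes J :: "nat \<Rightarrow> nat set"
  assumes "\<And>j. j < r \<Longrightarrow> finite (J j)"
  shows "closed {x :: nat \<Rightarrow> 'a::euclidean_space. linked r J x}"
proof -
  define Box where "Box i0 = {\<nu> :: nat \<Rightarrow> real. (\<forall>i. \<nu> i \<in> {-1..1}) \<and> \<nu> i0 = 1}" for i0
  define S where "S = (\<Inter>j\<in>{..<r}. {p :: (nat \<Rightarrow> 'a) \<times> (nat \<Rightarrow> real).
    (\<Sum>i\<in>J j. snd p i *\<^sub>R (fst p i, 1::real)) = (\<Sum>i\<in>J 0. snd p i *\<^sub>R (fst p i, 1))})"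
  have "compact (\<Pi>\<^sub>E i\<in>UNIV. {-1..1::real} :: (nat \<Rightarrow> real) set)"
    using compactin_PiE[of "\<lambda>_. euclidean" UNIV "\<lambda>_. {-1..1::real}"]
    by (simp add: euclidean_product_topology)
  moreover have "Box i0 = (\<Pi>\<^sub>E i\<in>UNIV. {-1..1}) \<inter> {\<nu>. \<nu> i0 = 1}" for i0
    by (auto simp: Box_def PiE_UNIV_domain)
  moreover have "closed {\<nu> :: nat \<Rightarrow> real. \<nu> i0 = 1}" for i0
    by (intro closed_Collect_eq continuous_on_const continuous_on_product_coordinates)
  ultimately have Box: "compact (Box i0)" for i0 by (simp add: compact_Int_closed)
  have cont: "continuous_on UNIV (\<lambda>p :: (nat \<Rightarrow> 'a) \<times> (nat \<Rightarrow> real). fst p i)"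
    "continuous_on UNIV (\<lambda>p :: (nat \<Rightarrow> 'a) \<times> (nat \<Rightarrow> real). snd p i)" for i
    by (rule continuous_on_product_then_coordinatewise, rule continuous_on_fst, rule continuous_on_id,
        rule continuous_on_product_then_coordinatewise, rule continuous_on_snd, rule continuous_on_id)
  have "closed S" unfolding S_def
    by (intro closed_INT ballI closed_Collect_eq continuous_on_sum continuous_on_scaleR continuous_on_Pair
        continuous_on_const cont)
  have "linked r J x \<longleftrightarrow> (\<exists>i0\<in>\<Union>j<r. J j. \<exists>\<nu>\<in>Box i0. (x, \<nu>) \<in> S)" for x
    unfolding Box_def S_def by (subst linked_normalized, rule assms, assumption) simp
  then have "{x. linked r J x} = (\<Union>i0\<in>\<Union>j<r. J j. {x :: nat \<Rightarrow> 'a. \<exists>\<nu>\<in>Box i0. (x, \<nu>) \<in> S})"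
    by blast
  also have "closed \<dots>"
    by (intro closed_UN ballI closed_compact_projection \<open>closed S\<close> Box) (use assms in auto)
  finally show ?thesis .
qed

lemma linked_cong:
  assumes "\<And>j i. j < r \<Longrightarrow> i \<in> J j \<Longrightarrow> x i = y i"
  shows "linked r J x = linked r J y"
proof -
  have "(\<Sum>i\<in>J j. \<nu> i *\<^sub>R (x i, 1::real)) = (\<Sum>i\<in>J j. \<nu> i *\<^sub>R (y i, 1))" if "j < r" for j \<nu>
    using assms[OF that] by (intro sum.cong) auto
  then show ?thesis unfolding linked_def by (metis (no_types, lifting))
qed

text \<open>A dependence after moving point \<open>i\<close> either has coefficient 0 there, and
  then links \<open>x\<close> already, or can be scaled to coefficient 1. In the second case the new
  position lies in \<open>S\<close>, which is affine and does not contain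
  \<open>x i\<close>.\<close>

lemma linked_slice:
  fixes x :: "nat \<Rightarrow> 'a::euclidean_space"
  assumes disj: "disjoint_family_on J {..<r}" and fin: "\<And>j. j < r \<Longrightarrow> finite (J j)"
    and x: "\<not> linked r J x"
  shows "AE y in lborel. \<not> linked r J (x(i := y))"
proof (cases "\<exists>j<r. i \<in> J j")
  case False
  then have "linked r J (x(i := y)) = linked r J x" for y by (intro linked_cong) auto
  then show ?thesis using x by simp
next
  case True
  define S where "S = {y. \<exists>\<nu> C. \<nu> i = 1 \<and> (\<forall>j<r. (\<Sum>k\<in>J j. \<nu> k *\<^sub>R ((x(i := y)) k, 1::real)) = C)}"
  have "affine S"
    unfolding affine_def
  proof (intro ballI allI impI)
    fix y y' and u v :: real assume "y \<in> S" "y' \<in> S" "u + v = 1"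
    then obtain \<nu> C \<nu>' C' where *: "\<nu> i = 1" "\<And>j. j < r \<Longrightarrow> (\<Sum>k\<in>J j. \<nu> k *\<^sub>R ((x(i := y)) k, 1::real)) = C"
      "\<nu>' i = 1" "\<And>j. j < r \<Longrightarrow> (\<Sum>k\<in>J j. \<nu>' k *\<^sub>R ((x(i := y')) k, 1::real)) = C'"
      unfolding S_def by blast
    define \<mu> where "\<mu> k = u * \<nu> k + v * \<nu>' k" for k
    have "(\<Sum>k\<in>J j. \<mu> k *\<^sub>R ((x(i := u *\<^sub>R y + v *\<^sub>R y')) k, 1::real)) = u *\<^sub>R C + v *\<^sub>R C'" if "j < r" for j
    proof -
      \<comment> \<open>At \<open>k = i\<close> both coefficients are 1, so the expression is linear
        in the moving point as well; elsewhere the two tuples agree.\<close>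
      have "\<mu> k *\<^sub>R ((x(i := u *\<^sub>R y + v *\<^sub>R y')) k, 1::real)
        = u *\<^sub>R (\<nu> k *\<^sub>R ((x(i := y)) k, 1)) + v *\<^sub>R (\<nu>' k *\<^sub>R ((x(i := y')) k, 1))" for k
        using *(1,3) \<open>u + v = 1\<close> by (cases "k = i") (simp_all add: \<mu>_def scaleR_add_left)
      then show ?thesis
        by (simp only: sum.distrib scaleR_sum_right[symmetric] *(2)[OF that] *(4)[OF that])
    qed
    moreover have "\<mu> i = 1" using * \<open>u + v = 1\<close> by (simp add: \<mu>_def)
    ultimately show "u *\<^sub>R y + v *\<^sub>R y' \<in> S" unfolding S_def by blast
  qed
  moreover have "x i \<notin> S"
  proof
    assume "x i \<in> S"
    then obtain \<nu> C where \<nu>: "\<nu> i = 1" "\<forall>j<r. (\<Sum>k\<in>J j. \<nu> k *\<^sub>R (x k, 1::real)) = C"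
      unfolding S_def mem_Collect_eq fun_upd_triv by blast
    have "\<exists>j<r. \<exists>k\<in>J j. \<nu> k \<noteq> 0" using True \<nu>(1) by (metis zero_neq_one)
    then show False using x \<nu>(2) unfolding linked_def by blast
  qed
  ultimately have "AE y in lborel. y \<notin> S" by (rule AE_not_in_affine)
  then show ?thesis
  proof (rule AE_mp, intro AE_I2 impI notI)
    fix y assume "y \<notin> S" "linked r J (x(i := y))"
    then obtain \<nu> C j1 i1 where \<nu>: "\<And>j. j < r \<Longrightarrow> (\<Sum>k\<in>J j. \<nu> k *\<^sub>R ((x(i := y)) k, 1::real)) = C"
      "j1 < r" "i1 \<in> J j1" "\<nu> i1 \<noteq> 0" unfolding linked_def by blast
    show False
    proof (cases "\<nu> i = 0")
      case True
      have "(\<Sum>k\<in>J j. \<nu> k *\<^sub>R (x k, 1::real)) = C" if "j < r" for j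
        unfolding \<nu>(1)[OF that, symmetric] using True by (intro sum.cong) auto
      then show False using x \<nu> unfolding linked_def by blast
    next
      case False
      have "(\<Sum>k\<in>J j. (\<nu> k / \<nu> i) *\<^sub>R ((x(i := y)) k, 1::real)) = (1 / \<nu> i) *\<^sub>R C" if "j < r" for j
        unfolding \<nu>(1)[OF that, symmetric] scaleR_sum_right by (intro sum.cong) auto
      then have "y \<in> S" using False unfolding S_def by (intro CollectI exI[of _ "\<lambda>k. \<nu> k / \<nu> i"]) auto
      then show False using \<open>y \<notin> S\<close> by blast
    qed
  qed
qed

text \<open>Closedness was shown in the space of all sequences; \<open>g\<close> maps tuples into it
  measurably by filling in 0.\<close>

lemma pred_not_linked:
  fixes J :: "nat \<Rightarrow> nat set"
  assumes "\<And>j. j < r \<Longrightarrow> J j \<subseteq> {..<N}"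
  shows "Measurable.pred (PiM {..<N} (\<lambda>_. lborel :: 'a::euclidean_space measure)) (\<lambda>x. \<not> linked r J x)"
proof -
  define g :: "(nat \<Rightarrow> 'a) \<Rightarrow> nat \<Rightarrow> 'a" where "g x i = (if i < N then x i else 0)" for x i
  have fin: "finite (J j)" if "j < r" for j using assms[OF that] finite_subset by blast
  have "g \<in> borel_measurable (PiM {..<N} (\<lambda>_. lborel))"
  proof (rule measurable_coordinatewise_then_product)
    fix i show "(\<lambda>x. g x i) \<in> borel_measurable (PiM {..<N} (\<lambda>_. lborel))"
      unfolding g_def by (cases "i < N") auto
  qed
  moreover have "Measurable.pred borel (\<lambda>x :: nat \<Rightarrow> 'a. \<not> linked r J x)"
    using borel_closed[OF closed_linked[of r J, OF fin]] by (intro pred_intros_logic) (simp add: pred_def)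
  ultimately have "Measurable.pred (PiM {..<N} (\<lambda>_. lborel)) (\<lambda>x. \<not> linked r J (g x))"
    by (rule measurable_compose)
  moreover have "linked r J (g x) = linked r J x" for x
    by (rule linked_cong) (use assms in \<open>auto simp: g_def\<close>)
  ultimately show ?thesis by simp
qed

text \<open>Greedy choice: each new set avoids as much of the current intersection as its size
  permits, so the intersection loses \<open>card X - k j\<close> elements until it is empty. The
  second alternative states the resulting size without subtraction; intersecting with
  \<open>X\<close> covers the empty family.\<close>

lemma subsets_with_empty_intersection:
  fixes X :: "'x set" and k :: "nat \<Rightarrow> nat"
  assumes "finite X"
  shows "(\<And>j. j < r \<Longrightarrow> k j \<le> card X) \<Longrightarrow>
    \<exists>T. (\<forall>j<r. T j \<subseteq> X \<and> card (T j) = k j) \<and>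
      (X \<inter> (\<Inter>j<r. T j) = {} \<or> card (X \<inter> (\<Inter>j<r. T j)) + r * card X \<le> (\<Sum>j<r. k j) + card X)"
proof (induction r)
  case 0
  then show ?case by simp
next
  case (Suc r)
  then obtain T where T: "\<forall>j<r. T j \<subseteq> X \<and> card (T j) = k j"
    "X \<inter> (\<Inter>j<r. T j) = {} \<or> card (X \<inter> (\<Inter>j<r. T j)) + r * card X \<le> (\<Sum>j<r. k j) + card X"
    by fastforce
  define Z where "Z = X \<inter> (\<Inter>j<r. T j)"
  have Z: "Z \<subseteq> X" "finite Z" using assms by (auto simp: Z_def)
  have "k r \<le> card X" using Suc.prems by simp
  have "\<exists>R\<subseteq>X. card R = k r \<and> (Z \<inter> R = {} \<or> card (Z \<inter> R) + card X \<le> card Z + k r)"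
  \<comment> \<open>The new set fits outside \<open>Z\<close>, or it must contain all of
    \<open>X - Z\<close> and fills up from \<open>Z\<close>.\<close>
  proof (cases "k r \<le> card (X - Z)")
    case True
    then obtain R where "R \<subseteq> X - Z" "card R = k r" by (meson obtain_subset_with_card_n)
    then show ?thesis by (intro exI[of _ R]) auto
  next
    case False
    have cXZ: "card (X - Z) + card Z = card X"
      using Z assms by (simp add: card_Diff_subset card_mono)
    then have "k r - card (X - Z) \<le> card Z" using \<open>k r \<le> card X\<close> by simp
    then obtain R where R: "R \<subseteq> Z" "card R = k r - card (X - Z)" "finite R"
      by (meson obtain_subset_with_card_n)
    have "finite (X - Z)" "(X - Z) \<inter> R = {}" using R(1) assms by auto
    then have "card ((X - Z) \<union> R) = card (X - Z) + card R" using R(3) by (intro card_Un_disjoint)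
    then have "card ((X - Z) \<union> R) = k r" using R(2) False by simp
    moreover have "Z \<inter> ((X - Z) \<union> R) = R" using R(1) by blast
    moreover have "card R + card X \<le> card Z + k r" using R(2) False cXZ by simp
    moreover have "(X - Z) \<union> R \<subseteq> X" using R(1) Z(1) by blast
    ultimately show ?thesis by (intro exI[of _ "(X - Z) \<union> R"]) simp
  qed
  then obtain R where R: "R \<subseteq> X" "card R = k r"
    "Z \<inter> R = {} \<or> card (Z \<inter> R) + card X \<le> card Z + k r" by blast
  have ZR: "X \<inter> (\<Inter>j<Suc r. (T(r := R)) j) = Z \<inter> R"
    unfolding Z_def by (auto simp: lessThan_Suc)
  have "card (Z \<inter> R) + Suc r * card X \<le> (\<Sum>j<Suc r. k j) + card X" if "Z \<inter> R \<noteq> {}"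
  proof -
    have "card Z + r * card X \<le> (\<Sum>j<r. k j) + card X" using T(2) that unfolding Z_def by blast
    moreover have "card (Z \<inter> R) + card X \<le> card Z + k r" using R(3) that by blast
    ultimately show ?thesis by simp
  qed
  then have "Z \<inter> R = {} \<or> card (Z \<inter> R) + Suc r * card X \<le> (\<Sum>j<Suc r. k j) + card X" by blast
  then have "X \<inter> (\<Inter>j<Suc r. (T(r := R)) j) = {} \<or>
      card (X \<inter> (\<Inter>j<Suc r. (T(r := R)) j)) + Suc r * card X \<le> (\<Sum>j<Suc r. k j) + card X"
    unfolding ZR .
  moreover have "(T(r := R)) j \<subseteq> X \<and> card ((T(r := R)) j) = k j" if "j < Suc r" for j
    using T(1) R(1,2) that by (cases "j = r") simp_all
  ultimately show ?case by (intro exI[of _ "T(r := R)"] conjI allI impI) simp_all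
qed

lemma affine_basis_independent:
  fixes \<mu> :: "'a::euclidean_space \<Rightarrow> real"
  assumes "(\<Sum>p\<in>insert 0 Basis. \<mu> p *\<^sub>R (p, 1::real)) = 0" "p \<in> insert 0 Basis"
  shows "\<mu> p = 0"
proof -
  have z: "(0::'a) \<notin> Basis" by auto
  have 1: "(\<Sum>p\<in>Basis. \<mu> p *\<^sub>R p) = 0" "\<mu> 0 + (\<Sum>p\<in>Basis. \<mu> p) = 0"
    using assms(1) z by (auto simp: prod_eq_iff fst_sum snd_sum)
  have "\<mu> b = 0" if "b \<in> Basis" for b
  proof -
    have "(\<Sum>p\<in>Basis. \<mu> p *\<^sub>R p) \<bullet> b = \<mu> b" using that by simp
    then show ?thesis using 1(1) by simp
  qed
  then show ?thesis using 1(2) assms(2) by auto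
qed

text \<open>The points of each part are placed at distinct vertices of the simplex \<open>X\<close>
  so that no vertex is occupied by all parts; the bound on the total size allows this. As the lifted
  vertices are independent, a dependence gives every part the same coefficient at each vertex, and a
  part that leaves the vertex unoccupied forces it to be 0.\<close>

lemma exists_not_linked:
  assumes disj: "disjoint_family_on J {..<r}" and fin: "\<And>j. j < r \<Longrightarrow> finite (J j)"
    and card: "\<And>j. j < r \<Longrightarrow> card (J j) \<le> DIM('a) + 1"
    and sum: "(\<Sum>j<r. card (J j)) \<le> (r - 1) * (DIM('a) + 1)" and "r > 0"
  shows "\<exists>x :: nat \<Rightarrow> 'a::euclidean_space. \<not> linked r J x"
proof -
  define X where "X = insert (0::'a) Basis"
  have X: "finite X" "card X = DIM('a) + 1" by (auto simp: X_def)
  have "\<exists>T. (\<forall>j<r. T j \<subseteq> X \<and> card (T j) = card (J j)) \<and>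
      (X \<inter> (\<Inter>j<r. T j) = {} \<or> card (X \<inter> (\<Inter>j<r. T j)) + r * card X \<le> (\<Sum>j<r. card (J j)) + card X)"
    by (rule subsets_with_empty_intersection) (use X card in simp_all)
  then obtain T where T0: "(\<forall>j<r. T j \<subseteq> X \<and> card (T j) = card (J j)) \<and>
      (X \<inter> (\<Inter>j<r. T j) = {} \<or> card (X \<inter> (\<Inter>j<r. T j)) + r * card X \<le> (\<Sum>j<r. card (J j)) + card X)" ..
  have T: "T j \<subseteq> X" "card (T j) = card (J j)" if "j < r" for j
    using conjunct1[OF T0] that by simp_all
  have "card (X \<inter> (\<Inter>j<r. T j)) = 0"
  proof (rule disjE[OF conjunct2[OF T0]])
    have "(r - 1) * card X + card X = r * card X" using \<open>r > 0\<close>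
      by (metis Suc_pred add.commute mult_Suc One_nat_def)
    moreover assume "card (X \<inter> (\<Inter>j<r. T j)) + r * card X \<le> (\<Sum>j<r. card (J j)) + card X"
    moreover have "(\<Sum>j<r. card (J j)) \<le> (r - 1) * card X" unfolding X(2) by (rule sum)
    ultimately show ?thesis by linarith
  qed simp
  then have empty: "X \<inter> (\<Inter>j<r. T j) = {}" using X(1) by auto
  have "\<exists>f. bij_betw f (J j) (T j)" if "j < r" for j
    using finite_same_card_bij[OF fin[OF that] finite_subset[OF T(1)[OF that] X(1)]] T(2)[OF that] by simp
  then obtain f where f: "\<And>j. j < r \<Longrightarrow> bij_betw (f j) (J j) (T j)" by metis
  \<comment> \<open>Disjointness makes the part of an index unique, so the separate bijections
    combine into one tuple.\<close>
  define own where "own i = (THE j. j < r \<and> i \<in> J j)" for i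
  have own: "own i = j" if "j < r" "i \<in> J j" for i j
    unfolding own_def using that disj by (intro the_equality) (auto simp: disjoint_family_on_def)
  define x where "x i = f (own i) i" for i
  have "\<not> linked r J x"
  proof
    assume "linked r J x"
    then obtain \<nu> C j1 i1 where \<nu>: "\<And>j. j < r \<Longrightarrow> (\<Sum>i\<in>J j. \<nu> i *\<^sub>R (x i, 1::real)) = C"
      "j1 < r" "i1 \<in> J j1" "\<nu> i1 \<noteq> 0" unfolding linked_def by blast
    \<comment> \<open>The coefficients of part \<open>j\<close> carried over to the vertices, with 0
      at unoccupied ones.\<close>
    define \<mu> where "\<mu> j p = (if p \<in> T j then \<nu> (inv_into (J j) (f j) p) else 0)" for j p
    have C: "(\<Sum>p\<in>X. \<mu> j p *\<^sub>R (p, 1::real)) = C" if "j < r" for j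
    proof -
      have "(\<Sum>p\<in>X. \<mu> j p *\<^sub>R (p, 1::real)) = (\<Sum>p\<in>T j. \<nu> (inv_into (J j) (f j) p) *\<^sub>R (p, 1))"
        unfolding \<mu>_def using T(1)[OF that] X(1)
        by (intro sum.mono_neutral_cong_right) (auto simp: zero_prod_def)
      also have "\<dots> = (\<Sum>i\<in>J j. \<nu> i *\<^sub>R (x i, 1))"
        using f[OF that] own[OF that]
        by (intro sum.reindex_bij_betw[OF f[OF that], symmetric, THEN trans] sum.cong refl)
           (auto simp: x_def bij_betw_def)
      finally show ?thesis using \<nu>(1)[OF that] by simp
    qed
    have "\<mu> j p = 0" if "j < r" "p \<in> X" for j p
    proof -
      obtain l where l: "l < r" "p \<notin> T l" using empty \<open>p \<in> X\<close> by blast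
      have "(\<Sum>p\<in>X. (\<mu> j p - \<mu> l p) *\<^sub>R (p, 1::real)) = 0"
        using C[OF \<open>j < r\<close>] C[OF l(1)] by (simp only: scaleR_diff_left sum_subtractf) simp
      then have "\<mu> j p - \<mu> l p = 0"
        unfolding X_def by (rule affine_basis_independent[of "\<lambda>p. \<mu> j p - \<mu> l p"]) (use that X_def in auto)
      then show ?thesis using l by (simp add: \<mu>_def)
    qed
    moreover have "f j1 i1 \<in> T j1" using bij_betwE[OF f[OF \<nu>(2)]] \<nu>(3) by blast
    moreover have "inv_into (J j1) (f j1) (f j1 i1) = i1"
      using bij_betw_inv_into_left[OF f[OF \<nu>(2)] \<nu>(3)] .
    ultimately show False using T(1)[OF \<nu>(2)] \<nu>(2,4) unfolding \<mu>_def by (metis (full_types) subsetD)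
  qed
  then show ?thesis by blast
qed

text \<open>Convex weights for \<open>c\<close> in every part have the common lifted sum
  \<open>(c, 1)\<close>. Injectivity on each part transfers them from points to indices, and
  disjointness merges them into one function.\<close>

lemma tverberg_point_linked:
  assumes disj: "disjoint_family_on J {..<r}" and fin: "\<And>j. j < r \<Longrightarrow> finite (J j)" and "r > 0"
    and inj: "\<And>j. j < r \<Longrightarrow> inj_on x (J j)" and c: "\<And>j. j < r \<Longrightarrow> c \<in> convex hull (x ` J j)"
  shows "linked r J x"
proof -
  have "\<exists>u. sum u (x ` J j) = 1 \<and> (\<Sum>y\<in>x ` J j. u y *\<^sub>R y) = c" if "j < r" for j
    using c[OF that] fin[OF that] by (auto simp: convex_hull_finite)
  then obtain u where u: "\<And>j. j < r \<Longrightarrow> sum (u j) (x ` J j) = 1"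
    "\<And>j. j < r \<Longrightarrow> (\<Sum>y\<in>x ` J j. u j y *\<^sub>R y) = c" by metis
  define own where "own i = (THE j. j < r \<and> i \<in> J j)" for i
  have own: "own i = j" if "j < r" "i \<in> J j" for i j
    unfolding own_def using that disj by (intro the_equality) (auto simp: disjoint_family_on_def)
  define \<nu> where "\<nu> i = u (own i) (x i)" for i
  have 1: "(\<Sum>i\<in>J j. \<nu> i) = 1" if "j < r" for j
    using u(1)[OF that] own[OF that] by (simp add: sum.reindex[OF inj[OF that]] \<nu>_def)
  have 2: "(\<Sum>i\<in>J j. \<nu> i *\<^sub>R x i) = c" if "j < r" for j
    using u(2)[OF that] own[OF that] by (simp add: sum.reindex[OF inj[OF that]] \<nu>_def)
  have "(\<Sum>i\<in>J j. \<nu> i *\<^sub>R (x i, 1::real)) = (c, 1)" if "j < r" for j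
    using 1[OF that] 2[OF that] by (simp add: prod_eq_iff fst_sum snd_sum)
  moreover have "\<exists>i\<in>J 0. \<nu> i \<noteq> 0"
    using 1[OF \<open>r > 0\<close>] by (metis sum.neutral zero_neq_one)
  ultimately show ?thesis using \<open>r > 0\<close> unfolding linked_def by blast
qed

text \<open>Caratheodory's theorem shrinks each part to at most d + 1 indices. This is essential, as
  d + 2 lifted points are always dependent and would link the parts trivially. Only finitely many
  such families exist, and each is almost surely not linked.\<close>

lemma AE_no_tverberg_point:
  assumes "N \<le> (r - 1) * (DIM('a) + 1)" "r > 0"
  shows "AE x in PiM {..<N} (\<lambda>_. lborel :: 'a::euclidean_space measure).
    \<forall>J c. disjoint_family_on J {..<r} \<longrightarrow> (\<forall>j<r. J j \<subseteq> {..<N}) \<longrightarrow> \<not> (\<forall>j<r. c \<in> convex hull (x ` J j))"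
proof -
  let ?M = "PiM {..<N} (\<lambda>_. lborel :: 'a measure)"
  define F where "F = {U \<in> (\<Pi>\<^sub>E j\<in>{..<r}. Pow {..<N}). disjoint_family_on U {..<r} \<and> (\<forall>j<r. card (U j) \<le> DIM('a) + 1)}"
  have "finite F" unfolding F_def by (intro finite_subset[OF _ finite_PiE[of "{..<r}" "\<lambda>_. Pow {..<N}"]]) auto
  have "AE x in ?M. \<not> linked r U x" if "U \<in> F" for U
  proof -
    have U: "U j \<subseteq> {..<N}" "finite (U j)" "card (U j) \<le> DIM('a) + 1" if "j < r" for j
      using \<open>U \<in> F\<close> that finite_subset[of "U j" "{..<N}"] by (auto simp: F_def)
    have disj: "disjoint_family_on U {..<r}" using that by (simp add: F_def)
    have "(\<Sum>j<r. card (U j)) = card (\<Union>j<r. U j)"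
      using disj U by (intro card_UN_disjoint[symmetric]) (auto simp: disjoint_family_on_def)
    also have "\<dots> \<le> card {..<N}" using U(1) by (intro card_mono) auto
    finally have "(\<Sum>j<r. card (U j)) \<le> (r - 1) * (DIM('a) + 1)" using assms(1) by simp
    then obtain x0 :: "nat \<Rightarrow> 'a" where x0: "\<not> linked r U x0"
      using exists_not_linked[OF disj U(2,3) _ \<open>r > 0\<close>] by blast
    show ?thesis
    proof (rule AE_PiM_slices)
      show "Measurable.pred ?M (\<lambda>x. \<not> linked r U x)" by (rule pred_not_linked) (rule U)
      show "AE y in lborel. \<not> linked r U (x(i := y))" if "\<not> linked r U x" for x :: "nat \<Rightarrow> 'a" and i
        by (rule linked_slice[OF disj U(2) that])
      show "restrict x0 {..<N} \<in> {..<N} \<rightarrow>\<^sub>E UNIV" by simp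
      have "linked r U (restrict x0 {..<N}) = linked r U x0"
        by (rule linked_cong) (use U in auto)
      then show "\<not> linked r U (restrict x0 {..<N})" using x0 by simp
    qed simp
  qed
  then have "AE x in ?M. \<forall>U\<in>F. \<not> linked r U x" using \<open>finite F\<close> by (intro AE_finite_allI) auto
  then show ?thesis
  proof (rule AE_mp, intro AE_I2 impI allI notI)
    fix x :: "nat \<Rightarrow> 'a" and J c
    assume notl: "\<forall>U\<in>F. \<not> linked r U x" and J: "disjoint_family_on J {..<r}" "\<forall>j<r. J j \<subseteq> {..<N}"
      and c: "\<forall>j<r. c \<in> convex hull (x ` J j)"
    have "\<exists>V\<subseteq>J j. inj_on x V \<and> card V \<le> DIM('a) + 1 \<and> c \<in> convex hull (x ` V)" if "j < r" for j
    proof -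
      have "c \<in> {c. \<exists>S. finite S \<and> S \<subseteq> x ` J j \<and> card S \<le> DIM('a) + 1 \<and> c \<in> convex hull S}"
        using c that unfolding Convex.caratheodory[of "x ` J j", symmetric] by blast
      then obtain S where S: "S \<subseteq> x ` J j" "card S \<le> DIM('a) + 1" "c \<in> convex hull S" by blast
      \<comment> \<open>One index is chosen for each point of \<open>S\<close>, which makes
        \<open>x\<close> injective on \<open>V\<close>.\<close>
      obtain V where "V \<subseteq> J j" "inj_on x V" "S = x ` V" using S(1) unfolding subset_image_inj by blast
      then show ?thesis using S(2,3) by (intro exI[of _ V]) (auto simp: card_image)
    qed
    then obtain V where V: "\<And>j. j < r \<Longrightarrow> V j \<subseteq> J j" "\<And>j. j < r \<Longrightarrow> inj_on x (V j)"
      "\<And>j. j < r \<Longrightarrow> card (V j) \<le> DIM('a) + 1" "\<And>j. j < r \<Longrightarrow> c \<in> convex hull (x ` V j)" by metis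
    define U where "U = restrict V {..<r}"
    have UV: "U j = V j" if "j < r" for j using that by (simp add: U_def)
    have VN: "V j \<subseteq> {..<N}" if "j < r" for j using V(1)[OF that] J(2) that by blast
    have disj: "disjoint_family_on U {..<r}"
      using J(1) V(1) unfolding disjoint_family_on_def by (simp add: UV) blast
    have "U \<in> F" using disj VN V(3) by (simp add: F_def UV) (simp add: U_def restrict_PiE_iff)
    moreover have "linked r U x"
    proof (rule tverberg_point_linked[OF disj _ \<open>r > 0\<close>])
      fix j assume "j < r"
      then show "finite (U j)" "inj_on x (U j)" "c \<in> convex hull (x ` U j)"
        using V VN finite_subset[OF VN] by (simp_all add: UV)
    qed
    ultimately show False using notl by blast
  qed
qed

text \<open>The slicing criterion again, now with a single point removed from each slice.
  Distinctness lets disjoint index sets become disjoint sets of points.\<close>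

lemma AE_inj_on:
  fixes N :: nat
  shows "AE x in PiM {..<N} (\<lambda>_. lborel :: 'a::euclidean_space measure). inj_on x {..<N}"
proof -
  let ?M = "PiM {..<N} (\<lambda>_. lborel :: 'a measure)"
  have "AE x in ?M. x i \<noteq> x j" if ij: "i < N" "j < N" "i \<noteq> j" for i j
  proof -
    obtain b :: 'a where b: "b \<in> Basis" by (meson nonempty_Basis ex_in_conv)
    show ?thesis
    proof (rule AE_PiM_slices)
      have m: "(\<lambda>x. x i) \<in> measurable ?M borel" "(\<lambda>x. x j) \<in> measurable ?M borel"
        using measurable_component_singleton[of i "{..<N}" "\<lambda>_. lborel :: 'a measure"]
          measurable_component_singleton[of j "{..<N}" "\<lambda>_. lborel :: 'a measure"] ij by auto
      show "Measurable.pred ?M (\<lambda>x. x i \<noteq> x j)"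
        using pred_sets2[OF _ borel_measurable_diff[OF m], of "- {0}"] by simp
      show "AE y in lborel. (x(k := y)) i \<noteq> (x(k := y)) j" if "x i \<noteq> x j" for x :: "nat \<Rightarrow> 'a" and k
      proof -
        have *: "AE y in lborel. y \<noteq> a" for a :: 'a
          by (rule AE_lborel_singleton)
        consider "k = i" | "k = j" | "k \<noteq> i" "k \<noteq> j" by blast
        then show ?thesis
        proof cases
          case 1 then show ?thesis using *[of "x j"] ij by simp
        next
          case 2 then show ?thesis using *[of "x i"] ij by (simp add: eq_commute)
        qed (use that in simp)
      qed
      show "(\<lambda>k\<in>{..<N}. if k = i then b else 0) \<in> {..<N} \<rightarrow>\<^sub>E UNIV" by simp
      show "(\<lambda>k\<in>{..<N}. if k = i then b else 0) i \<noteq> (\<lambda>k\<in>{..<N}. if k = i then b else 0) j"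
        using ij b by auto
    qed simp
  qed
  then have "AE x in ?M. \<forall>p\<in>{p \<in> {..<N} \<times> {..<N}. fst p \<noteq> snd p}. x (fst p) \<noteq> x (snd p)"
    by (intro AE_finite_allI) auto
  then show ?thesis by (rule AE_mp, intro AE_I2 impI) (auto simp: inj_on_def)
qed

section \<open>Polygon partitions\<close>

lemma polygon_partition_of_weights:
  fixes a :: "nat \<Rightarrow> real^'n::finite"
  assumes inj: "inj_on a {..<N}"
    and s: "\<And>i. i < N \<Longrightarrow> s i < r" and \<nu>: "\<And>i. i < N \<Longrightarrow> 0 \<le> \<nu> i"
    and sum1: "\<And>j. j < r \<Longrightarrow> (\<Sum>i | i < N \<and> s i = j. \<nu> i) = 1"
    and x: "\<And>j. j < r \<Longrightarrow> x j = (\<Sum>i | i < N \<and> s i = j. \<nu> i *\<^sub>R a i)"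
  shows "\<And>j. j < r \<Longrightarrow> x j \<in> convex hull (a ` {i. i < N \<and> s i = j})"
    and "regular_gon_vertices r (x ` {..<r}) \<Longrightarrow> bij_betw x {..<r} (x ` {..<r}) \<Longrightarrow>
      polygon_partition r (a ` {..<N}) (\<lambda>j. a ` {i. i < N \<and> s i = j}) (x ` {..<r})"
proof -
  show hull: "x j \<in> convex hull (a ` {i. i < N \<and> s i = j})" if "j < r" for j
    unfolding x[OF that] using sum1[OF that] \<nu>
    by (intro convex_sum convex_convex_hull hull_inc) auto
  assume "regular_gon_vertices r (x ` {..<r})" "bij_betw x {..<r} (x ` {..<r})"
  moreover have "disjoint_family_on (\<lambda>j. a ` {i. i < N \<and> s i = j}) {..<r}"
    using inj by (auto simp: disjoint_family_on_def inj_on_def)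
  moreover have "(\<Union>j<r. a ` {i. i < N \<and> s i = j}) = a ` {..<N}" using s by auto
  ultimately show "polygon_partition r (a ` {..<N}) (\<lambda>j. a ` {i. i < N \<and> s i = j}) (x ` {..<r})"
    using hull unfolding polygon_partition_def by auto
qed

text \<open>One complex coordinate, along \<open>U\<close>, and d - 2 real ones, along the
  orthogonal complement. The equations number 2(r - 2) + (d - 1)(r - 1) = (r - 1)(d + 1) - 2,
  exactly one fewer than the points.\<close>

lemma polygon_parallel_to_plane:
  fixes S :: "(real^'n::finite) set" and e :: "nat \<Rightarrow> 'n"
  assumes "r \<ge> 3" and d: "CARD('n) \<ge> 2" and e: "bij_betw e {..<CARD('n)} (UNIV :: 'n set)"
    and gen: "generic_set S" and card: "card S = tverberg_number r CARD('n) - 2"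
    and U: "subspace U" "dim U = 2"
  shows "\<exists>A V. polygon_partition r S A V \<and> parallel_to (convex hull V) U"
proof -
  let ?d = "CARD('n)"
  define N where "N = card S"
  have N: "N + 1 = (r - 1) * (?d + 1)" 
  proof -
    have "1 * 1 \<le> (r - 1) * (?d + 1)" using \<open>r \<ge> 3\<close> by (intro mult_le_mono) auto
    then show ?thesis by (simp add: N_def card tverberg_number_def)
  qed
  have "2 * 3 \<le> (r - 1) * (?d + 1)" using \<open>r \<ge> 3\<close> d by (intro mult_le_mono) auto
  then have "N \<ge> 1" using N by linarith
  obtain a where a: "bij_betw a {..N - 1} S"
    and fg: "fourier_generic (N - 1) (\<lambda>t. \<Sum>i\<le>N - 1. t i *\<^sub>R a i)"
    using gen unfolding generic_set_def N_def by blast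
  have "{..N - 1} = {..<N}" using \<open>N \<ge> 1\<close> by auto
  then have a': "inj_on a {..<N}" "a ` {..<N} = S" using a by (auto simp: bij_betw_def)
  obtain O' where O': "O' \<subseteq> U" "pairwise orthogonal O'" "\<And>x. x \<in> O' \<Longrightarrow> norm x = 1"
    "independent O'" "card O' = dim U" "span O' = U"
    using orthonormal_basis_subspace[OF U(1)] by metis
  then obtain u v where uv: "O' = {u, v}" "u \<noteq> v" using U(2) by (metis card_2_iff)
  have on: "u \<bullet> u = 1" "v \<bullet> v = 1" "u \<bullet> v = 0"
    using O'(2,3) uv by (auto simp: pairwise_def orthogonal_def dot_square_norm)
  define W where "W = {y. \<forall>x\<in>U. orthogonal x y}"
  have "dim {y \<in> UNIV. \<forall>x\<in>U. orthogonal x y} + dim U = dim (UNIV :: (real^'n) set)"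
    by (rule dim_subspace_orthogonal_to_vectors) (use U in auto)
  then have dimW: "dim W + 2 = ?d" using U(2) by (simp add: W_def)
  obtain B where B: "B \<subseteq> W" "independent B" "W \<subseteq> span B" "card B = dim W"
    using basis_exists[of W] by blast
  have "finite B" using B(2) by (rule independent_imp_finite)
  have UO: "u \<in> U" "v \<in> U" using O'(1) uv by auto
  have span: "span (B \<union> {u} \<union> {v}) = UNIV"
  proof -
    have "x \<in> span (B \<union> {u} \<union> {v})" for x
    proof -
      obtain y z where yz: "y \<in> span U" "\<And>w. w \<in> span U \<Longrightarrow> orthogonal z w" "x = y + z"
        using orthogonal_subspace_decomp_exists[of U x] by metis
      have "z \<in> W" using yz(2) unfolding W_def by (auto intro: span_base simp: orthogonal_commute)
      then have "z \<in> span (B \<union> {u} \<union> {v})" using B(3) span_mono[of B "B \<union> {u} \<union> {v}"] by blast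
      moreover have "y \<in> span {u, v}" using yz(1) U(1) O'(6) uv(1) by (metis span_eq_iff)
      then have "y \<in> span (B \<union> {u} \<union> {v})" using span_mono[of "{u, v}" "B \<union> {u} \<union> {v}"] by blast
      ultimately show ?thesis unfolding yz(3) by (rule span_add[rotated])
    qed
    then show ?thesis by auto
  qed
  have bound: "2 * (1 * (r - 2)) + (card B + 1) * (r - 1) < N"
  proof -
    obtain k where k: "r = k + 3" using \<open>r \<ge> 3\<close> by (metis le_add_diff_inverse2)
    have "?d = card B + 2" using dimW B(4) by simp
    then show ?thesis using N by (simp add: k algebra_simps)
  qed
  have spanB: "span (B \<union> (\<lambda>_. u) ` {..<1::nat} \<union> (\<lambda>_. v) ` {..<1::nat}) = UNIV"
    using span by (simp add: lessThan_Suc)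
  have onm: "u \<bullet> u = (if m = m' then 1 else 0)" "v \<bullet> v = (if m = m' then 1 else 0)" "u \<bullet> v = 0"
    if "m < 1" "m' < 1" for m m' :: nat using that on by auto
  have BW: "b \<bullet> u = 0" "b \<bullet> v = 0" if "b \<in> B" "m < 1" for b and m :: nat
    using that B(1) UO by (auto simp: W_def orthogonal_def inner_commute)
  have "r \<ge> 2" using \<open>r \<ge> 3\<close> by simp
  obtain s \<nu> c p q \<beta> where s: "\<And>i. i < N \<Longrightarrow> s i < r" and \<nu>: "\<And>i. i < N \<Longrightarrow> 0 \<le> \<nu> i"
    and sum1: "\<And>j. j < r \<Longrightarrow> (\<Sum>i | i < N \<and> s i = j. \<nu> i) = 1"
    and x: "\<And>j. j < r \<Longrightarrow> (\<Sum>i | i < N \<and> s i = j. \<nu> i *\<^sub>R a i) =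
        c + (cos (2 * pi * real j / real r) *\<^sub>R p + sin (2 * pi * real j / real r) *\<^sub>R q)"
    and p: "p = (\<Sum>m<1::nat. Re (\<beta> m) *\<^sub>R u + Im (\<beta> m) *\<^sub>R v)"
    and q: "q = (\<Sum>m<1::nat. - Im (\<beta> m) *\<^sub>R u + Re (\<beta> m) *\<^sub>R v)"
    and pq: "p \<bullet> q = 0" "p \<bullet> p = q \<bullet> q"
    by (rule polygon_configuration[where u = "\<lambda>_. u" and v = "\<lambda>_. v" and a = a and h = 1 and B = B and r = r and N = N])
       (rule \<open>finite B\<close> bound \<open>r \<ge> 2\<close> onm BW spanB | (rule that; assumption) | assumption)+
  have "p \<in> U" "q \<in> U"
    unfolding p q using U(1) UO by (auto intro!: subspace_sum subspace_add subspace_diff subspace_scale subspace_neg)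
  define y where "y j = (\<Sum>i | i < N \<and> s i = j. \<nu> i *\<^sub>R a i)" for j
  have y: "y j = c + (cos (2 * pi * real j / real r) *\<^sub>R p + sin (2 * pi * real j / real r) *\<^sub>R q)" if "j < r" for j
    using x[OF that] by (simp add: y_def)
  \<comment> \<open>For \<open>p = 0\<close> all parts would share the point \<open>c\<close>, a
    Tverberg partition that genericity forbids.\<close>
  have "p \<noteq> 0"
  proof
    assume "p = 0"
    then have "q = 0" using pq(2) by simp
    have "(\<Sum>i | i < N \<and> s i = j. \<nu> i *\<^sub>R a i) = c" if "j < r" for j
      using x[OF that] \<open>p = 0\<close> \<open>q = 0\<close> by simp
    moreover have "N \<le> (r - 1) * (?d + 1)" using N by linarith
    ultimately show False
      using fourier_generic_no_tverberg[OF fg \<open>N \<ge> 1\<close> _ \<open>r \<ge> 2\<close> e, of s \<nu> c] s \<nu> sum1 by blast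
  qed
  have "polygon_partition r (a ` {..<N}) (\<lambda>j. a ` {i. i < N \<and> s i = j}) (y ` {..<r})"
    using polygon_partition_of_weights(2)[OF a'(1), of s r \<nu> y] s \<nu> sum1 y_def
      regular_gon_vertices_cos_sin[OF \<open>p \<noteq> 0\<close> pq y] by blast
  then have "polygon_partition r S (\<lambda>j. a ` {i. i < N \<and> s i = j}) (y ` {..<r})"
    unfolding a'(2) .
  moreover have "convex hull (y ` {..<r}) \<subseteq> (+) c ` U"
  proof (rule hull_minimal)
    show "y ` {..<r} \<subseteq> (+) c ` U"
      using y \<open>p \<in> U\<close> \<open>q \<in> U\<close> U(1) by (auto intro!: imageI subspace_add subspace_scale)
    show "convex ((+) c ` U)" using subspace_imp_convex[OF U(1)] by (rule convex_translation)
  qed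
  ultimately show ?thesis unfolding parallel_to_def by blast
qed

section \<open>Polygons in complex 1-flats\<close>

lemma complex_coord_add: "complex_coord e (x + y) k = complex_coord e x k + complex_coord e y k"
  and complex_coord_scaleR: "complex_coord e (t *\<^sub>R x) k = of_real t * complex_coord e x k"
  by (simp_all add: complex_coord_def complex_eq_iff)

lemma convex_complex_line:
  assumes "complex_line e L"
  shows "convex L"
proof -
  obtain w where L: "L = {x. \<exists>z. \<forall>k < CARD('a) div 2. complex_coord e x k = z * complex_coord e w k}"
    using assms unfolding complex_line_def by blast
  show ?thesis
  proof (rule convexI)
    fix x y :: "real^'a" and s t :: real assume "x \<in> L" "y \<in> L"
    then obtain z z' where "\<forall>k < CARD('a) div 2. complex_coord e x k = z * complex_coord e w k"
      "\<forall>k < CARD('a) div 2. complex_coord e y k = z' * complex_coord e w k" unfolding L by blast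
    then show "s *\<^sub>R x + t *\<^sub>R y \<in> L"
      unfolding L by (intro CollectI exI[of _ "of_real s * z + of_real t * z'"])
        (simp add: complex_coord_add complex_coord_scaleR algebra_simps)
  qed
qed

text \<open>Here \<open>B\<close> is empty and all d/2 coordinates are complex. Together with the
  weights this makes d(r - 2) + (r - 1) equations, again one fewer than the points.\<close>

lemma polygon_in_complex_1_flat:
  fixes e :: "nat \<Rightarrow> 'n::finite"
  assumes "r \<ge> 3" and d: "CARD('n) \<ge> 2" and e: "bij_betw e {..<CARD('n)} (UNIV :: 'n set)"
    and "even CARD('n)"
  shows "almost_any_points (tverberg_number r CARD('n) - CARD('n))
          (\<lambda>S :: (real^'n) set. \<exists>A V F. polygon_partition r S A V \<and>
             complex_1_flat e F \<and> convex hull V \<subseteq> F)"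
proof -
  let ?d = "CARD('n)"
  define h where "h = ?d div 2"
  define N where "N = tverberg_number r ?d - ?d"
  have "r \<ge> 2" using \<open>r \<ge> 3\<close> by simp
  have h: "?d = 2 * h" using \<open>even ?d\<close> by (simp add: h_def)
  obtain k where k: "r = k + 3" using \<open>r \<ge> 3\<close> by (metis le_add_diff_inverse2)
  have N: "N = (k + 1) * (2 * h + 1) + 2"
    by (simp add: N_def tverberg_number_def k h algebra_simps)
  have Nle: "N \<le> (r - 1) * (?d + 1)" using d by (simp add: N k h algebra_simps)
  have bound: "2 * (h * (r - 2)) + (card ({} :: (real^'n) set) + 1) * (r - 1) < N"
    by (simp add: N k algebra_simps)
  define u v :: "nat \<Rightarrow> real^'n" where "u m = axis (e (2 * m)) 1" and "v m = axis (e (2 * m + 1)) 1" for m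
  have e_inj: "e i = e j \<longleftrightarrow> i = j" if "i < ?d" "j < ?d" for i j
    using e that by (auto simp: bij_betw_def inj_on_def)
  have uu: "u m \<bullet> u m' = (if m = m' then 1 else 0)" if "m < h" "m' < h" for m m'
    using e_inj[of "2 * m" "2 * m'"] that by (simp add: u_def inner_axis_axis h)
  have vv: "v m \<bullet> v m' = (if m = m' then 1 else 0)" if "m < h" "m' < h" for m m'
    using e_inj[of "2 * m + 1" "2 * m' + 1"] that by (simp add: v_def inner_axis_axis h)
  have uv: "u m \<bullet> v m' = 0" if "m < h" "m' < h" for m m'
  proof -
    have "2 * m \<noteq> 2 * m' + 1" by presburger
    then show ?thesis using e_inj[of "2 * m" "2 * m' + 1"] that by (simp add: u_def v_def inner_axis_axis h)
  qed
  have "axis i 1 \<in> u ` {..<h} \<union> v ` {..<h}" for i :: 'n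
  proof -
    obtain l where l: "l < ?d" "i = e l" using e by (metis bij_betw_def imageE lessThan_iff UNIV_I)
    show ?thesis
    proof (cases "even l")
      case True
      then show ?thesis using l h by (auto simp: u_def elim!: evenE)
    next
      case False
      then show ?thesis using l h by (auto simp: v_def elim!: oddE)
    qed
  qed
  then have "(Basis :: (real^'n) set) \<subseteq> {} \<union> u ` {..<h} \<union> v ` {..<h}" by (auto simp: Basis_vec_def)
  then have span: "span ({} \<union> u ` {..<h} \<union> v ` {..<h}) = UNIV"
    using span_mono span_Basis by (metis top.extremum_uniqueI)
  have cc: "complex_coord e y m = Complex (y \<bullet> u m) (y \<bullet> v m)" for y m
    by (simp add: complex_coord_def u_def v_def inner_axis)
  have "\<exists>A V F. polygon_partition r (a ` {..<N}) A V \<and> complex_1_flat e F \<and> convex hull V \<subseteq> F"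
    if inj: "inj_on a {..<N}"
      and notv: "\<forall>J c. disjoint_family_on J {..<r} \<longrightarrow> (\<forall>j<r. J j \<subseteq> {..<N}) \<longrightarrow>
                   \<not> (\<forall>j<r. c \<in> convex hull (a ` J j))" for a :: "nat \<Rightarrow> real^'n"
  proof -
    obtain s \<nu> c p q \<beta> where s: "\<And>i. i < N \<Longrightarrow> s i < r" and \<nu>: "\<And>i. i < N \<Longrightarrow> 0 \<le> \<nu> i"
      and sum1: "\<And>j. j < r \<Longrightarrow> (\<Sum>i | i < N \<and> s i = j. \<nu> i) = 1"
      and x: "\<And>j. j < r \<Longrightarrow> (\<Sum>i | i < N \<and> s i = j. \<nu> i *\<^sub>R a i) =
          c + (cos (2 * pi * real j / real r) *\<^sub>R p + sin (2 * pi * real j / real r) *\<^sub>R q)"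
      and p: "p = (\<Sum>m<h. Re (\<beta> m) *\<^sub>R u m + Im (\<beta> m) *\<^sub>R v m)"
      and q: "q = (\<Sum>m<h. - Im (\<beta> m) *\<^sub>R u m + Re (\<beta> m) *\<^sub>R v m)"
      and pq: "p \<bullet> q = 0" "p \<bullet> p = q \<bullet> q"
      by (rule polygon_configuration[where u = u and v = v and a = a and h = h and B = "{}" and r = r and N = N])
         (rule finite.emptyI bound \<open>r \<ge> 2\<close> uu vv uv span | (rule that; assumption) | assumption | erule emptyE)+
    have pi: "p \<bullet> u m = Re (\<beta> m)" "p \<bullet> v m = Im (\<beta> m)" if "m < h" for m
      by (rule combination_orthonormal_pairs(1,2)[OF uu vv uv p that]; assumption)+
    have qi: "q \<bullet> u m = - Im (\<beta> m)" "q \<bullet> v m = Re (\<beta> m)" if "m < h" for m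
      by (rule combination_orthonormal_pairs(1,2)[OF uu vv uv q that]; assumption)+
    define y where "y j = (\<Sum>i | i < N \<and> s i = j. \<nu> i *\<^sub>R a i)" for j
    have y: "y j = c + (cos (2 * pi * real j / real r) *\<^sub>R p + sin (2 * pi * real j / real r) *\<^sub>R q)" if "j < r" for j
      using x[OF that] by (simp add: y_def)
    have hull: "y j \<in> convex hull (a ` {i. i < N \<and> s i = j})" if "j < r" for j
      using polygon_partition_of_weights(1)[OF inj, of s r \<nu> y] s \<nu> sum1 y_def that by blast
    have "p \<noteq> 0"
    \<comment> \<open>If \<open>p = 0\<close>, the point \<open>c\<close> lies in the hulls of all
      parts, which the almost sure condition \<open>notv\<close> rules out.\<close>
    proof
      assume "p = 0"
      then have "q = 0" using pq(2) by simp
      then have "c \<in> convex hull (a ` {i. i < N \<and> s i = j})" if "j < r" for j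
        using hull[OF that] y[OF that] \<open>p = 0\<close> by simp
      moreover have "disjoint_family_on (\<lambda>j. {i. i < N \<and> s i = j}) {..<r}"
        by (auto simp: disjoint_family_on_def)
      ultimately show False using notv[rule_format, of "\<lambda>j. {i. i < N \<and> s i = j}" c] by auto
    qed
    define L where "L = {x. \<exists>z. \<forall>k < CARD('n) div 2. complex_coord e x k = z * complex_coord e p k}"
    have L: "complex_line e L" unfolding complex_line_def L_def using \<open>p \<noteq> 0\<close> by blast
    have "polygon_partition r (a ` {..<N}) (\<lambda>j. a ` {i. i < N \<and> s i = j}) (y ` {..<r})"
      using polygon_partition_of_weights(2)[OF inj, of s r \<nu> y] s \<nu> sum1 y_def
        regular_gon_vertices_cos_sin[OF \<open>p \<noteq> 0\<close> pq y] by blast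
    moreover have "complex_1_flat e ((+) c ` L)" unfolding complex_1_flat_def using L by blast
    moreover have "convex hull (y ` {..<r}) \<subseteq> (+) c ` L"
    proof (rule hull_minimal)
      \<comment> \<open>In complex coordinates \<open>q\<close> is \<i> times \<open>p\<close>, so
        this combination is the multiple of \<open>p\<close> by s + \<i> t.\<close>
      have "s *\<^sub>R p + t *\<^sub>R q \<in> L" for s t
        unfolding L_def h_def[symmetric]
        by (intro CollectI exI[of _ "Complex s t"])
           (simp add: cc inner_add_left pi qi complex_eq_iff)
      then show "y ` {..<r} \<subseteq> (+) c ` L" using y by auto
      show "convex ((+) c ` L)" using convex_complex_line[OF L] by (rule convex_translation)
    qed
    ultimately show ?thesis by blast
  qed
  note flat = this
  have "N \<le> (r - 1) * (DIM(real^'n) + 1)" "r > 0" using Nle \<open>r \<ge> 3\<close> by simp_all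
  from AE_inj_on AE_no_tverberg_point[OF this] show ?thesis
    unfolding almost_any_points_def N_def[symmetric]
  proof eventually_elim
    case (elim a)
    then show ?case by (rule flat)
  qed
qed

theorem theorem4p1:
  fixes r :: nat and e :: "nat \<Rightarrow> 'n::finite"
  assumes "r \<ge> 3" and "CARD('n) \<ge> 2"
    and "bij_betw e {..<CARD('n)} (UNIV :: 'n set)"
  shows
    "(\<forall>S :: (real^'n) set. generic_set S \<and> card S = tverberg_number r CARD('n) - 2 \<longrightarrow>
        (\<forall>U. subspace U \<and> dim U = 2 \<longrightarrow>
          (\<exists>A V. polygon_partition r S A V \<and> parallel_to (convex hull V) U)))
     \<and>
     (even CARD('n) \<longrightarrow>
        almost_any_points (tverberg_number r CARD('n) - CARD('n))
          (\<lambda>S :: (real^'n) set. \<exists>A V F. polygon_partition r S A V \<and>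
             complex_1_flat e F \<and> convex hull V \<subseteq> F)
        \<and> polygon_number TYPE('n) r \<le> (r - 2) * (CARD('n) + 1) + 2)"
proof (intro conjI allI impI)
  fix S U :: "(real^'n) set"
  assume "generic_set S \<and> card S = tverberg_number r CARD('n) - 2" "subspace U \<and> dim U = 2"
  then show "\<exists>A V. polygon_partition r S A V \<and> parallel_to (convex hull V) U"
    using polygon_parallel_to_plane[OF assms] by blast
next
  assume "even CARD('n)"
  from polygon_in_complex_1_flat[OF assms this]
  show flat: "almost_any_points (tverberg_number r CARD('n) - CARD('n))
          (\<lambda>S :: (real^'n) set. \<exists>A V F. polygon_partition r S A V \<and>
             complex_1_flat e F \<and> convex hull V \<subseteq> F)" .
  have "tverberg_number r CARD('n) - CARD('n) = (r - 2) * (CARD('n) + 1) + 2"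
  proof -
    \<comment> \<open>Writing \<open>r\<close> as \<open>k + 3\<close> clears the truncated
      subtractions from (r - 1)(d + 1) + 1 - d = (r - 2)(d + 1) + 2.\<close>
    obtain k where "r = k + 3" using \<open>r \<ge> 3\<close> by (metis le_add_diff_inverse2)
    then show ?thesis by (simp add: tverberg_number_def algebra_simps)
  qed
  moreover have "almost_any_points (tverberg_number r CARD('n) - CARD('n))
      (\<lambda>S :: (real^'n) set. \<exists>A V. polygon_partition r S A V)"
    using flat unfolding almost_any_points_def by (rule eventually_mono) blast
  ultimately show "polygon_number TYPE('n) r \<le> (r - 2) * (CARD('n) + 1) + 2"
    unfolding polygon_number_def by (intro Least_le) simp
qed

end
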